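(* Let $\Omega\subset\mathbb R^N$, $N\ge 2$, be a bounded $C^2$ domain such that $0\in\partial\Omega$, and let $g:\mathbb R\to\mathbb R$ be a continuous function satisfying $s\,g(s)\ge 0$ for all $s\in\mathbb R$. Let $u\in C^1(\overline\Omega\setminus\{0\})$ be a solution of $$-\Delta u=0\ \text{ in }\Omega,\qquad \frac{\partial u}{\partial \mathbf n}+g(u)=0\ \text{ on }\partial\Omega\setminus\{0\},$$ such that, as $x\to 0$, $u(x)=o(|x|^{2-N})$ if $N\ge 3$, or $u(x)=o(\ln|x|)$ if $N=2$. Then $u$ is constant and $g(u)=0$.
   Context: $\mathbf n$ denotes the outward unit normal vector on $\partial\Omega$. *)

theory Defs
  imports "HOL-Analysis.Analysis" "HOL-Library.Landau_Symbols"
begin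

text \<open>The derivative of the gradient field \<open>Df\<close> is the Hessian of \<open>f\<close>.\<close>

definition C2_on :: "('a::euclidean_space \<Rightarrow> real) \<Rightarrow> 'a set \<Rightarrow> bool" where
  "C2_on f U \<longleftrightarrow>
     (\<exists>(Df :: 'a \<Rightarrow> 'a) (D2f :: 'a \<Rightarrow> 'a \<Rightarrow>\<^sub>L 'a).
        (\<forall>x\<in>U. GDERIV f x :> Df x) \<and>
        (\<forall>x\<in>U. (Df has_derivative blinfun_apply (D2f x)) (at x)) \<and>
        continuous_on U D2f)"

definition partial_deriv :: "'a::real_normed_vector \<Rightarrow> ('a \<Rightarrow> real) \<Rightarrow> 'a \<Rightarrow> real" where
  "partial_deriv b f x = deriv (\<lambda>t. f (x + t *\<^sub>R b)) 0"

definition laplacian :: "('a::euclidean_space \<Rightarrow> real) \<Rightarrow> 'a \<Rightarrow> real" where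
  "laplacian f x = (\<Sum>b\<in>Basis. partial_deriv b (partial_deriv b f) x)"

text \<open>Near \<open>p\<close>, the set \<open>\<Omega>\<close> is the part lying above the graph of a \<open>C\<^sup>2\<close> function, in
  orthonormal coordinates whose last axis is the unit vector \<open>e\<close>. The function of the remaining
  coordinates is represented by a function \<open>\<gamma>\<close> on the whole space that is constant along \<open>e\<close>.\<close>

definition C2_graph_near ::
    "'a::euclidean_space set \<Rightarrow> 'a \<Rightarrow> 'a \<Rightarrow> ('a \<Rightarrow> real) \<Rightarrow> bool" where
  "C2_graph_near \<Omega> p e \<gamma> \<longleftrightarrow>
     norm e = 1 \<and> C2_on \<gamma> UNIV \<and> (\<forall>x t. \<gamma> (x + t *\<^sub>R e) = \<gamma> x) \<and>
     (\<exists>r>0. \<Omega> \<inter> ball p r = {x \<in> ball p r. x \<bullet> e > \<gamma> x})"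

definition C2_domain :: "'a::euclidean_space set \<Rightarrow> bool" where
  "C2_domain \<Omega> \<longleftrightarrow>
     open \<Omega> \<and> connected \<Omega> \<and> \<Omega> \<noteq> {} \<and> (\<forall>p\<in>frontier \<Omega>. \<exists>e \<gamma>. C2_graph_near \<Omega> p e \<gamma>)"

text \<open>In such coordinates \<open>\<Omega>\<close> is locally the set where \<open>\<gamma> x - x \<bullet> e < 0\<close>, so the outward unit
  normal is the normalised gradient of this function. By \<open>has_outward_normal_unique\<close> below it does
  not depend on the choice of \<open>e\<close> and \<open>\<gamma>\<close>.\<close>

definition has_outward_normal :: "'a::euclidean_space set \<Rightarrow> 'a \<Rightarrow> 'a \<Rightarrow> bool" where
  "has_outward_normal \<Omega> p \<nu> \<longleftrightarrow>
     (\<exists>e \<gamma> d. C2_graph_near \<Omega> p e \<gamma> \<and> GDERIV \<gamma> p :> d \<and> \<nu> = sgn (d - e))"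

definition outward_normal :: "'a::euclidean_space set \<Rightarrow> 'a \<Rightarrow> 'a" where
  "outward_normal \<Omega> p = (THE \<nu>. has_outward_normal \<Omega> p \<nu>)"

text \<open>\<open>u\<close> is \<open>C\<^sup>1\<close> in the open set \<open>\<Omega>\<close>, and \<open>u\<close> and its gradient extend continuously to \<open>S\<close>, where
  \<open>\<Omega> \<subseteq> S \<subseteq> closure \<Omega>\<close>. On \<open>S - \<Omega>\<close> the field \<open>Du\<close> is the (unique) continuous extension of the
  gradient.\<close>

definition C1_up_to ::
    "'a::euclidean_space set \<Rightarrow> 'a set \<Rightarrow> ('a \<Rightarrow> real) \<Rightarrow> ('a \<Rightarrow> 'a) \<Rightarrow> bool" where
  "C1_up_to \<Omega> S u Du \<longleftrightarrow>
     continuous_on S u \<and> continuous_on S Du \<and> (\<forall>x\<in>\<Omega>. GDERIV u x :> Du x)"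

lemma GDERIV_descent:
  fixes \<rho> :: "'a::euclidean_space \<Rightarrow> real"
  assumes "GDERIV \<rho> p :> a" "\<rho> p = 0" "a \<bullet> h < 0"
  shows "\<forall>\<^sub>F t in at_right 0. \<rho> (p + t *\<^sub>R h) < 0"
proof -
  have d: "(\<rho> has_derivative (\<lambda>k. k \<bullet> a)) (at (p + 0 *\<^sub>R h))"
    using assms(1) by (simp add: gderiv_def)
  have "((\<lambda>t. \<rho> (p + t *\<^sub>R h)) has_derivative (\<lambda>t. (t *\<^sub>R h) \<bullet> a)) (at 0)"
    by (rule has_derivative_compose[where g=\<rho> and f="\<lambda>t. p + t *\<^sub>R h", OF _ d])
       (auto intro!: derivative_eq_intros)
  then have "((\<lambda>t. \<rho> (p + t *\<^sub>R h)) has_real_derivative (h \<bullet> a)) (at 0)"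
    by (simp add: has_field_derivative_def mult.commute[of _ "h \<bullet> a"])
  then have "\<exists>e>0. \<forall>k>0. k < e \<longrightarrow> \<rho> (p + (0 + k) *\<^sub>R h) < \<rho> (p + 0 *\<^sub>R h)"
    using assms(3) by (intro DERIV_neg_dec_right) (auto simp: inner_commute)
  then show ?thesis
    using assms(2) by (auto simp: eventually_at_right_field)
qed

lemma C2_graph_near_frontier:
  assumes "C2_graph_near \<Omega> p e \<gamma>" "p \<in> frontier \<Omega>"
  shows "\<gamma> p = p \<bullet> e"
proof -
  obtain r where r: "r > 0" "\<Omega> \<inter> ball p r = {x \<in> ball p r. x \<bullet> e > \<gamma> x}"
    using assms(1) by (auto simp: C2_graph_near_def)
  have "\<forall>x. isCont \<gamma> x"
    using assms(1) unfolding C2_graph_near_def C2_on_def gderiv_def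
    by (meson UNIV_I has_derivative_continuous)
  then have c: "continuous_on UNIV (\<lambda>x. x \<bullet> e - \<gamma> x)"
    by (intro continuous_intros) (simp add: continuous_on_eq_continuous_at)
  show ?thesis
  proof (rule ccontr)
    assume "\<gamma> p \<noteq> p \<bullet> e"
    then consider "p \<bullet> e - \<gamma> p > 0" | "p \<bullet> e - \<gamma> p < 0" by linarith
    then show False
    proof cases
      case 1
      define V where "V = ball p r \<inter> {x. 0 < x \<bullet> e - \<gamma> x}"
      have "open V" unfolding V_def
        by (intro open_Int open_ball open_Collect_less c continuous_intros)
      moreover have "p \<in> V" "V \<subseteq> \<Omega>" using 1 r by (auto simp: V_def)
      ultimately have "p \<in> interior \<Omega>" by (auto intro: interiorI)
      then show False using assms(2) by (simp add: frontier_def)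
    next
      case 2
      define V where "V = ball p r \<inter> {x. x \<bullet> e - \<gamma> x < 0}"
      have "open V" unfolding V_def
        by (intro open_Int open_ball open_Collect_less c continuous_intros)
      moreover have "p \<in> V" using 2 r(1) by (simp add: V_def)
      moreover have "V \<inter> \<Omega> = {}"
      proof -
        have "V \<inter> \<Omega> \<subseteq> (\<Omega> \<inter> ball p r) \<inter> {x. x \<bullet> e - \<gamma> x < 0}" by (auto simp: V_def)
        also have "\<dots> = {}" unfolding r(2) by auto
        finally show ?thesis by simp
      qed
      moreover have "p \<in> closure \<Omega>" using assms(2) by (simp add: frontier_def)
      ultimately show False by (metis disjoint_iff open_Int_closure_eq_empty)
    qed
  qed
qed

lemma has_outward_normal_norm:
  assumes "has_outward_normal \<Omega> p \<nu>"
  shows "norm \<nu> = 1"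
proof -
  obtain e \<gamma> d where *: "C2_graph_near \<Omega> p e \<gamma>" "GDERIV \<gamma> p :> d" "\<nu> = sgn (d - e)"
    using assms by (auto simp: has_outward_normal_def)
  have "d \<noteq> e"
  proof
    assume "d = e"
    then have e: "(\<gamma> has_derivative (\<lambda>k. k \<bullet> e)) (at (p + 0 *\<^sub>R e))"
      using *(2) by (simp add: gderiv_def)
    have "((\<lambda>t. \<gamma> (p + t *\<^sub>R e)) has_derivative (\<lambda>t. (t *\<^sub>R e) \<bullet> e)) (at 0)"
      by (rule has_derivative_compose[where g=\<gamma> and f="\<lambda>t. p + t *\<^sub>R e", OF _ e])
         (auto intro!: derivative_eq_intros)
    moreover have "(\<lambda>t. \<gamma> (p + t *\<^sub>R e)) = (\<lambda>_. \<gamma> p)"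
      using *(1) by (auto simp: C2_graph_near_def)
    ultimately have "((\<lambda>_::real. \<gamma> p) has_derivative (\<lambda>t. (t *\<^sub>R e) \<bullet> e)) (at 0)" by simp
    then have "(\<lambda>t. (t *\<^sub>R e) \<bullet> e) = (\<lambda>_::real. 0)"
      by (rule has_derivative_unique) (rule has_derivative_const)
    then have "(1 *\<^sub>R e) \<bullet> e = 0" by metis
    then show False using *(1) by (auto simp: C2_graph_near_def)
  qed
  then show ?thesis using *(3) by (simp add: norm_sgn)
qed

lemma has_outward_normal_exists:
  assumes "C2_domain \<Omega>" "p \<in> frontier \<Omega>"
  shows "\<exists>\<nu>. has_outward_normal \<Omega> p \<nu>"
proof -
  obtain e \<gamma> where *: "C2_graph_near \<Omega> p e \<gamma>"
    using assms unfolding C2_domain_def by blast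
  then obtain d where "GDERIV \<gamma> p :> d"
    by (auto simp: C2_graph_near_def C2_on_def)
  with * show ?thesis by (auto simp: has_outward_normal_def)
qed

lemma has_outward_normal_descent:
  assumes "has_outward_normal \<Omega> p \<nu>" "p \<in> frontier \<Omega>"
  shows "\<nu> \<bullet> h < 0 \<Longrightarrow> \<forall>\<^sub>F t in at_right 0. p + t *\<^sub>R h \<in> \<Omega>"
    and "\<nu> \<bullet> h > 0 \<Longrightarrow> \<forall>\<^sub>F t in at_right 0. p + t *\<^sub>R h \<notin> \<Omega>"
proof -
  obtain e \<gamma> d where *: "C2_graph_near \<Omega> p e \<gamma>" "GDERIV \<gamma> p :> d" "\<nu> = sgn (d - e)"
    using assms by (auto simp: has_outward_normal_def)
  obtain r where r: "r > 0" "\<Omega> \<inter> ball p r = {x \<in> ball p r. x \<bullet> e > \<gamma> x}"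
    using *(1) by (auto simp: C2_graph_near_def)
  have ne: "norm (d - e) > 0"
    using has_outward_normal_norm[OF assms(1)] *(3) by (cases "d = e") auto
  have sgn_iff: "\<nu> \<bullet> h = (d - e) \<bullet> h / norm (d - e)"
    by (simp add: *(3) sgn_div_norm divide_inverse mult.commute)
  have g1: "GDERIV (\<lambda>x. \<gamma> x - x \<bullet> e) p :> d - e"
    using *(2) unfolding gderiv_def
    by (auto intro!: derivative_eq_intros simp: inner_diff_right)
  have g2: "GDERIV (\<lambda>x. x \<bullet> e - \<gamma> x) p :> e - d"
    using *(2) unfolding gderiv_def
    by (auto intro!: derivative_eq_intros simp: inner_diff_right)
  have z: "\<gamma> p = p \<bullet> e" by (rule C2_graph_near_frontier[OF *(1) assms(2)])
  have "((\<lambda>t. p + t *\<^sub>R h) \<longlongrightarrow> p + 0 *\<^sub>R h) (at_right 0)"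
    by (intro tendsto_intros)
  then have "((\<lambda>t. p + t *\<^sub>R h) \<longlongrightarrow> p) (at_right 0)" by simp
  then have b: "\<forall>\<^sub>F t in at_right 0. p + t *\<^sub>R h \<in> ball p r"
    using r(1) by (intro topological_tendstoD) auto
  show "\<forall>\<^sub>F t in at_right 0. p + t *\<^sub>R h \<in> \<Omega>" if "\<nu> \<bullet> h < 0"
  proof -
    have "(d - e) \<bullet> h < 0" using that ne by (simp add: sgn_iff divide_less_0_iff)
    from GDERIV_descent[OF g1 _ this] z
    have "\<forall>\<^sub>F t in at_right 0. \<gamma> (p + t *\<^sub>R h) - (p + t *\<^sub>R h) \<bullet> e < 0" by simp
    with b show ?thesis by eventually_elim (use r(2) in auto)
  qed
  show "\<forall>\<^sub>F t in at_right 0. p + t *\<^sub>R h \<notin> \<Omega>" if "\<nu> \<bullet> h > 0"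
  proof -
    have "(e - d) \<bullet> h < 0" using that ne by (simp add: sgn_iff zero_less_divide_iff inner_diff_left)
    from GDERIV_descent[OF g2 _ this] z
    have "\<forall>\<^sub>F t in at_right 0. (p + t *\<^sub>R h) \<bullet> e - \<gamma> (p + t *\<^sub>R h) < 0" by simp
    with b show ?thesis
    proof eventually_elim
      case (elim t)
      then have "p + t *\<^sub>R h \<notin> \<Omega> \<inter> ball p r" unfolding r(2) by simp
      with elim show ?case by blast
    qed
  qed
qed

lemma has_outward_normal_unique:
  assumes "has_outward_normal \<Omega> p \<nu>" "has_outward_normal \<Omega> p \<mu>" "p \<in> frontier \<Omega>"
  shows "\<nu> = \<mu>"
proof (rule ccontr)
  assume ne: "\<nu> \<noteq> \<mu>"
  have n: "\<nu> \<bullet> \<nu> = 1" "\<mu> \<bullet> \<mu> = 1"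
    using has_outward_normal_norm assms by (metis norm_eq_1)+
  have "0 < (\<nu> - \<mu>) \<bullet> (\<nu> - \<mu>)" using ne by simp
  then have "\<nu> \<bullet> \<mu> < 1"
    using n by (simp add: inner_diff_left inner_diff_right inner_commute)
  then have "\<nu> \<bullet> (\<mu> - \<nu>) < 0" "\<mu> \<bullet> (\<mu> - \<nu>) > 0"
    using n by (simp_all add: inner_diff_right inner_commute)
  then have "\<forall>\<^sub>F t in at_right 0. p + t *\<^sub>R (\<mu> - \<nu>) \<in> \<Omega>"
    and "\<forall>\<^sub>F t in at_right 0. p + t *\<^sub>R (\<mu> - \<nu>) \<notin> \<Omega>"
    using has_outward_normal_descent assms by blast+
  then have "\<forall>\<^sub>F t in at_right (0::real). False"
    by eventually_elim auto
  then show False by simp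
qed

lemma outward_normal:
  assumes "C2_domain \<Omega>" "p \<in> frontier \<Omega>"
  shows "has_outward_normal \<Omega> p (outward_normal \<Omega> p)"
  unfolding outward_normal_def
  using has_outward_normal_exists[OF assms] has_outward_normal_unique[OF _ _ assms(2)]
  by (metis theI)

end

theory Submission
  imports Defs
begin

text \<open>Near \<open>0\<close> the function \<open>u\<close> is compared with \<open>c + \<epsilon> \<Phi>\<close>, where \<open>\<Phi>\<close> is strictly
  superharmonic, has positive outward normal derivative on the boundary near \<open>0\<close>, and grows like
  the fundamental solution at \<open>0\<close>. Such a \<open>\<Phi>\<close> exists only locally: globally the divergence theorem
  forbids it. As the boundary condition makes the normal derivative of \<open>u\<close> nonpositive where
  \<open>u > 0\<close>, letting \<open>\<epsilon>\<close> tend to \<open>0\<close> bounds \<open>u\<close> near \<open>0\<close> by its maximum over a small sphere around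
  \<open>0\<close>. Hence a positive supremum of \<open>u\<close> is attained away from \<open>0\<close>; Hopf's lemma excludes the
  boundary and the strong maximum principle makes \<open>u\<close> constant. The same applies to \<open>- u\<close>.\<close>

subsection \<open>Maximum principles for harmonic functions\<close>

text \<open>Why no global barrier exists: on \<Omega> minus a small ball at \<open>0\<close>, the
  flux through the boundary and the flux through the small sphere would both be positive, for a
  function that decays away from \<open>0\<close> like the fundamental solution, while the integral
  of its Laplacian is negative. The comparison is therefore local and takes a bound on a sphere as
  its datum. The comparison constant must be nonnegative for two reasons: the sign of
  \<open>g\<close> controls the normal derivative of \<open>u\<close> only where
  \<open>u > 0\<close>, and the growth condition yields only u - \<epsilon> \<Phi> \<le> 0 near
  \<open>0\<close>. Differentiability of \<open>u\<close> is given only inside \<Omega>, so every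
  argument at a boundary point runs along an inward segment and uses the continuous extension
  \<open>Du\<close> of the gradient. Finally \<open>g(u) = 0\<close> follows because the zero
  gradient of a constant extends to a boundary point other than \<open>0\<close>, where the boundary
  condition can be read off.\<close>

lemma GDERIV_line:
  fixes f :: "'a::euclidean_space \<Rightarrow> real"
  assumes "GDERIV f (x + t *\<^sub>R h) :> d"
  shows "((\<lambda>t. f (x + t *\<^sub>R h)) has_real_derivative d \<bullet> h) (at t)"
proof -
  have "((\<lambda>t. f (x + t *\<^sub>R h)) has_derivative (\<lambda>s. (s *\<^sub>R h) \<bullet> d)) (at t)"
    by (rule has_derivative_compose[where g=f and f="\<lambda>t. x + t *\<^sub>R h"])
       (use assms in \<open>auto intro!: derivative_eq_intros simp: gderiv_def\<close>)
  then show ?thesis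
    by (simp add: has_field_derivative_def inner_commute mult.commute[of _ "d \<bullet> h"])
qed

lemma has_derivative_line:
  fixes F :: "'a::euclidean_space \<Rightarrow> 'a"
  assumes "(F has_derivative H) (at x)"
  shows "((\<lambda>t. F (x + t *\<^sub>R h) \<bullet> k) has_real_derivative H h \<bullet> k) (at 0)"
proof -
  have "((\<lambda>t. F (x + t *\<^sub>R h)) has_derivative (\<lambda>s. H (s *\<^sub>R h))) (at 0)"
    by (rule has_derivative_compose[where g=F and f="\<lambda>t. x + t *\<^sub>R h"])
       (use assms in \<open>auto intro!: derivative_eq_intros\<close>)
  then have "((\<lambda>t. F (x + t *\<^sub>R h) \<bullet> k) has_derivative (\<lambda>s. H (s *\<^sub>R h) \<bullet> k)) (at 0)"
    by (rule has_derivative_inner_left)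
  then show ?thesis
    using linear_scale[OF has_derivative_linear[OF assms]]
    by (simp add: has_field_derivative_def mult.commute[of _ "H h \<bullet> k"])
qed

lemma eventually_line_in_open:
  fixes x h :: "'a::real_normed_vector"
  assumes "open U" "x \<in> U"
  shows "\<forall>\<^sub>F t in nhds 0. x + t *\<^sub>R h \<in> U"
proof -
  have "((\<lambda>t. x + t *\<^sub>R h) \<longlongrightarrow> x + 0 *\<^sub>R h) (nhds 0)"
    by (intro tendsto_intros filterlim_ident)
  then show ?thesis
    using topological_tendstoD[OF _ assms(1)] assms(2) by simp
qed

text \<open>The outer \<open>deriv\<close> in \<open>laplacian\<close> sees the inner one along a
  whole line segment, so the first partial derivatives have to be identified on a neighbourhood of
  \<open>x\<close> before the second ones are taken at \<open>x\<close>.\<close>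

lemma laplacian_eq_trace:
  fixes f :: "'a::euclidean_space \<Rightarrow> real"
  assumes U: "open U" "x \<in> U"
    and G: "\<And>y. y \<in> U \<Longrightarrow> GDERIV f y :> Df y"
    and H: "(Df has_derivative H) (at x)"
  shows "laplacian f x = (\<Sum>b\<in>Basis. H b \<bullet> b)"
proof -
  have pd: "partial_deriv b f y = Df y \<bullet> b" if "y \<in> U" for b y
    unfolding partial_deriv_def
    by (rule DERIV_imp_deriv, rule GDERIV_line) (use G[OF that] in simp)
  have "partial_deriv b (partial_deriv b f) x = H b \<bullet> b" for b
  proof -
    have "\<forall>\<^sub>F t in nhds 0. partial_deriv b f (x + t *\<^sub>R b) = Df (x + t *\<^sub>R b) \<bullet> b"
      using eventually_line_in_open[OF U] by eventually_elim (rule pd)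
    then have "deriv (\<lambda>t. partial_deriv b f (x + t *\<^sub>R b)) 0 = deriv (\<lambda>t. Df (x + t *\<^sub>R b) \<bullet> b) 0"
      by (rule deriv_cong_ev) simp
    also have "\<dots> = H b \<bullet> b"
      by (rule DERIV_imp_deriv, rule has_derivative_line[OF H])
    finally show ?thesis
      unfolding partial_deriv_def[of b "partial_deriv b f"] .
  qed
  then show ?thesis by (simp add: laplacian_def)
qed

text \<open>Restrict to the line in direction \<open>h\<close>. The slope \<psi> vanishes at
  \<open>0\<close>; if its derivative there were positive, the slope would be positive just to the
  right and \<open>w\<close> would rise above its maximum.\<close>

lemma second_derivative_nonpos_at_max:
  fixes w :: "'a::euclidean_space \<Rightarrow> real"
  assumes V: "open V" "x \<in> V"
    and G: "\<And>y. y \<in> V \<Longrightarrow> GDERIV w y :> Dw y"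
    and H: "(Dw has_derivative H) (at x)"
    and max: "\<And>y. y \<in> V \<Longrightarrow> w y \<le> w x"
  shows "H h \<bullet> h \<le> 0"
proof (rule ccontr)
  assume "\<not> H h \<bullet> h \<le> 0"
  then have pos: "H h \<bullet> h > 0" by simp
  define \<phi> where "\<phi> t = w (x + t *\<^sub>R h)" for t
  define \<psi> where "\<psi> t = Dw (x + t *\<^sub>R h) \<bullet> h" for t
  obtain e where e: "e > 0" "\<And>t. \<bar>t\<bar> < e \<Longrightarrow> x + t *\<^sub>R h \<in> V"
    using eventually_line_in_open[OF V, of h] by (auto simp: eventually_nhds_metric dist_real_def)
  have d\<phi>: "(\<phi> has_real_derivative \<psi> t) (at t)" if "\<bar>t\<bar> < e" for t
    unfolding \<phi>_def \<psi>_def by (rule GDERIV_line) (use G e(2)[OF that] in blast)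
  have d\<psi>: "(\<psi> has_real_derivative H h \<bullet> h) (at 0)"
    unfolding \<psi>_def by (rule has_derivative_line[OF H])
  have le: "\<phi> t \<le> \<phi> 0" if "\<bar>t\<bar> < e" for t
    using max[OF e(2)[OF that]] by (simp add: \<phi>_def)
  have "\<psi> 0 = 0"
    by (rule DERIV_local_max[OF d\<phi> e(1)]) (use e(1) le in auto)
  with DERIV_pos_inc_right[OF d\<psi> pos] obtain d where
    d: "d > 0" "\<And>t. 0 < t \<Longrightarrow> t < d \<Longrightarrow> \<psi> t > 0" by auto
  define t where "t = min d e / 2"
  have t: "0 < t" "t < d" "t < e" using d(1) e(1) by (auto simp: t_def min_def)
  have "\<phi> 0 < \<phi> t"
  proof (rule DERIV_pos_imp_increasing_open[OF t(1)])
    show "\<exists>y. (\<phi> has_real_derivative y) (at s) \<and> y > 0" if "0 < s" "s < t" for s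
      using d\<phi>[of s] d(2)[of s] that t by auto
    show "continuous_on {0..t} \<phi>"
      by (rule DERIV_continuous_on, rule DERIV_subset[OF d\<phi>]) (use t in auto)
  qed
  with le[of t] t show False by simp
qed

lemma gradient_zero_at_max:
  fixes w :: "'a::euclidean_space \<Rightarrow> real"
  assumes "open V" "x \<in> V" "GDERIV w x :> d" "\<And>y. y \<in> V \<Longrightarrow> w y \<le> w x"
  shows "d = 0"
proof -
  have "(\<lambda>h. h \<bullet> d) = (\<lambda>h. 0)"
    by (rule differential_zero_maxmin[of x V w]) (use assms in \<open>auto simp: gderiv_def\<close>)
  then have "d \<bullet> d = 0" by metis
  then show ?thesis by simp
qed

section \<open>Gradient, Hessian and Laplacian of a composite function\<close>

lemma GDERIV_compose_real:
  fixes q :: "'a::euclidean_space \<Rightarrow> real"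
  assumes q: "GDERIV q x :> Dq x" and f: "(f has_real_derivative f' (q x)) (at (q x))"
  shows "GDERIV (\<lambda>x. f (q x)) x :> f' (q x) *\<^sub>R Dq x"
proof -
  have "((\<lambda>x. f (q x)) has_derivative (\<lambda>h. f' (q x) * (h \<bullet> Dq x))) (at x)"
    by (rule has_derivative_compose[where g=f and f=q])
       (use assms in \<open>auto simp: gderiv_def has_field_derivative_def\<close>)
  then show ?thesis by (simp add: gderiv_def)
qed

lemma gradient_compose_real_has_derivative:
  fixes q :: "'a::euclidean_space \<Rightarrow> real"
  assumes q: "GDERIV q x :> Dq x" and Q: "(Dq has_derivative Q) (at x)"
    and f': "(f' has_real_derivative f'' (q x)) (at (q x))"
  shows "((\<lambda>x. f' (q x) *\<^sub>R Dq x) has_derivative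
      (\<lambda>h. f' (q x) *\<^sub>R Q h + (f'' (q x) * (h \<bullet> Dq x)) *\<^sub>R Dq x)) (at x)"
proof -
  have "((\<lambda>x. f' (q x)) has_derivative (\<lambda>h. f'' (q x) * (h \<bullet> Dq x))) (at x)"
    by (rule has_derivative_compose[where g=f' and f=q])
       (use assms in \<open>auto simp: gderiv_def has_field_derivative_def\<close>)
  from has_derivative_scaleR[OF this Q] show ?thesis .
qed

text \<open>With \<open>a = f' (q x)\<close>, \<open>c = f'' (q x)\<close> and
  \<open>d = Dq x\<close> this is the formula for the Laplacian of \<open>f (q x)\<close>:
  \<open>f'\<close> times the Laplacian of \<open>q\<close> plus \<open>f''\<close> times the
  squared gradient.\<close>

lemma trace_compose_real:
  fixes d :: "'a::euclidean_space"
  shows "(\<Sum>b\<in>Basis. (a *\<^sub>R Q b + (c * (b \<bullet> d)) *\<^sub>R d) \<bullet> b)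
    = a * (\<Sum>b\<in>Basis. Q b \<bullet> b) + c * (norm d)\<^sup>2"
proof -
  have "(norm d)\<^sup>2 = (\<Sum>b\<in>Basis. (d \<bullet> b) * (d \<bullet> b))"
    by (simp add: power2_norm_eq_inner euclidean_inner[of d d])
  then show ?thesis
    by (simp add: inner_add_left sum.distrib sum_distrib_left inner_commute[of d] mult_ac)
qed

text \<open>Harmonicity is phrased as a trace condition on the derivative of \<open>Du\<close>,
  because the maximum principle needs the Hessian as a linear map and the boundary arguments need
  this very field \<open>Du\<close>.\<close>

definition harmonic_gradient ::
    "'a::euclidean_space set \<Rightarrow> ('a \<Rightarrow> real) \<Rightarrow> ('a \<Rightarrow> 'a) \<Rightarrow> bool" where
  "harmonic_gradient U u Du \<longleftrightarrow> open U \<and> (\<forall>x\<in>U. GDERIV u x :> Du x) \<and>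
     (\<forall>x\<in>U. \<exists>H. (Du has_derivative H) (at x) \<and> (\<Sum>b\<in>Basis. H b \<bullet> b) = 0)"

text \<open>At a maximum all diagonal entries of the Hessian are nonpositive, hence so is the trace;
  but the trace of the sum is that of \<open>H\<close>, which is positive.\<close>

lemma harmonic_plus_strict_subharmonic_no_max:
  fixes u :: "'a::euclidean_space \<Rightarrow> real"
  assumes u: "harmonic_gradient U u Du" and V: "open V" "V \<subseteq> U" "x \<in> V"
    and G: "\<And>y. y \<in> V \<Longrightarrow> GDERIV \<phi> y :> D\<phi> y"
    and H: "(D\<phi> has_derivative H) (at x)" "(\<Sum>b\<in>Basis. H b \<bullet> b) > 0"
  shows "\<exists>y\<in>V. u y + \<phi> y > u x + \<phi> x"
proof (rule ccontr)
  assume "\<not> ?thesis"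
  then have max: "u y + \<phi> y \<le> u x + \<phi> x" if "y \<in> V" for y using that by force
  obtain K where K: "(Du has_derivative K) (at x)" "(\<Sum>b\<in>Basis. K b \<bullet> b) = 0"
    using u V unfolding harmonic_gradient_def by blast
  have g: "GDERIV (\<lambda>y. u y + \<phi> y) y :> Du y + D\<phi> y" if "y \<in> V" for y
    using u V G[OF that] that by (auto simp: harmonic_gradient_def intro!: GDERIV_add)
  have "(K b + H b) \<bullet> b \<le> 0" for b
    by (rule second_derivative_nonpos_at_max[OF V(1,3) g has_derivative_add[OF K(1) H(1)] max])
  then have "(\<Sum>b\<in>Basis. (K b + H b) \<bullet> b) \<le> 0" by (rule sum_nonpos)
  then show False using K(2) H(2) by (simp add: inner_add_left sum.distrib)
qed

text \<open>This replaces the first-order condition at a boundary point \<open>p\<close>. A positive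
  limit of the slope would make the slope positive on a short open segment into \<open>U\<close>,
  and \<open>w\<close> would increase strictly from its value at \<open>p\<close>.\<close>

lemma one_sided_derivative_nonpos:
  fixes w :: "'a::euclidean_space \<Rightarrow> real"
  assumes sub: "\<forall>\<^sub>F t in at_right 0. p + t *\<^sub>R h \<in> U" "U \<subseteq> S" "p \<in> S"
    and G: "\<And>x. x \<in> U \<Longrightarrow> GDERIV w x :> Dw x"
    and cont: "continuous (at p within S) w" "continuous (at p within S) Dw"
    and max: "\<forall>\<^sub>F t in at_right 0. w (p + t *\<^sub>R h) \<le> w p"
  shows "Dw p \<bullet> h \<le> 0"
proof (rule ccontr)
  assume "\<not> ?thesis"
  then have pos: "Dw p \<bullet> h > 0" by simp
  have "((\<lambda>t. p + t *\<^sub>R h) \<longlongrightarrow> p + 0 *\<^sub>R h) (at_right 0)"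
    by (intro tendsto_intros)
  then have lim: "((\<lambda>t. p + t *\<^sub>R h) \<longlongrightarrow> p) (at_right 0)" by simp
  have inS: "\<forall>\<^sub>F t in at_right 0. p + t *\<^sub>R h \<in> S"
    using sub(1) by eventually_elim (use sub(2) in auto)
  have w0: "((\<lambda>t. w (p + t *\<^sub>R h)) \<longlongrightarrow> w p) (at_right 0)"
    by (rule continuous_within_tendsto_compose[OF cont(1) inS lim])
  have "((\<lambda>t. Dw (p + t *\<^sub>R h)) \<longlongrightarrow> Dw p) (at_right 0)"
    by (rule continuous_within_tendsto_compose[OF cont(2) inS lim])
  then have "((\<lambda>t. Dw (p + t *\<^sub>R h) \<bullet> h) \<longlongrightarrow> Dw p \<bullet> h) (at_right 0)"
    by (intro tendsto_intros)
  then have "\<forall>\<^sub>F t in at_right 0. Dw (p + t *\<^sub>R h) \<bullet> h > 0"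
    using pos by (rule order_tendstoD)
  with sub(1) max have "\<forall>\<^sub>F t in at_right 0. p + t *\<^sub>R h \<in> U \<and> w (p + t *\<^sub>R h) \<le> w p \<and>
      Dw (p + t *\<^sub>R h) \<bullet> h > 0"
    by eventually_elim auto
  then obtain e where e: "e > 0" "\<And>t. 0 < t \<Longrightarrow> t < e \<Longrightarrow> p + t *\<^sub>R h \<in> U \<and>
      w (p + t *\<^sub>R h) \<le> w p \<and> Dw (p + t *\<^sub>R h) \<bullet> h > 0"
    by (auto simp: eventually_at_right_field)
  have d: "((\<lambda>t. w (p + t *\<^sub>R h)) has_real_derivative Dw (p + t *\<^sub>R h) \<bullet> h) (at t)"
    if "0 < t" "t < e" for t
    by (rule GDERIV_line) (use e(2)[OF that] G in blast)
  have "w (p + 0 *\<^sub>R h) < w (p + (e/2) *\<^sub>R h)"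
  proof (rule DERIV_pos_imp_increasing_open[where f="\<lambda>t. w (p + t *\<^sub>R h)"])
    show "\<exists>y. ((\<lambda>t. w (p + t *\<^sub>R h)) has_real_derivative y) (at s) \<and> y > 0"
      if "0 < s" "s < e/2" for s
      using d[of s] e(2)[of s] that by auto
    \<comment> \<open>At the endpoint \<open>s = 0\<close> only continuity relative to
      \<open>S\<close> is available; at the other points the derivative gives continuity.\<close>
    have "continuous (at s within {0..e/2}) (\<lambda>t. w (p + t *\<^sub>R h))" if "s \<in> {0..e/2}" for s
    proof (cases "s = 0")
      case True
      have "at 0 within {0..e/2} \<le> at_right (0::real)"
        by (auto simp: le_filter_def eventually_at_filter elim!: eventually_mono)
      from tendsto_mono[OF this w0] show ?thesis
        by (simp add: True continuous_within)
    next
      case False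
      then show ?thesis
        using d[of s] that e(1) by (auto intro!: continuous_at_imp_continuous_at_within DERIV_isCont)
    qed
    then show "continuous_on {0..e/2} (\<lambda>t. w (p + t *\<^sub>R h))"
      by (simp add: continuous_on_eq_continuous_within)
  qed (use e(1) in auto)
  with e(2)[of "e/2"] e(1) show False by simp
qed

section \<open>Hopf's lemma and the strong maximum principle\<close>

lemma GDERIV_norm_diff_sq:
  fixes c :: "'a::euclidean_space"
  shows "GDERIV (\<lambda>x. (norm (x - c))\<^sup>2) x :> 2 *\<^sub>R (x - c)"
  unfolding gderiv_def power2_norm_eq_inner
  by (auto intro!: derivative_eq_intros simp: inner_commute inner_diff_right)

text \<open>The barrier is \<open>\<bar>x - c\<bar>\<close> to the power \<open>- 2 n\<close>, which is strictly subharmonic in dimension \<open>n\<close>.\<close>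

lemma hopf_ball:
  fixes u :: "'a::euclidean_space \<Rightarrow> real"
  assumes u: "harmonic_gradient U u Du"
    and sub: "ball c R \<subseteq> U" "cball c R \<subseteq> S"
    and cont: "continuous_on S u" "continuous_on S Du"
    and p: "dist c p = R" and R: "R > 0"
    and less: "\<And>x. x \<in> ball c R \<Longrightarrow> u x < u p"
    and le: "\<And>x. x \<in> cball c R \<Longrightarrow> u x \<le> u p"
  shows "Du p \<bullet> (p - c) > 0"
proof -
  define n where "n = real DIM('a)"
  have n: "n > 0" by (simp add: n_def)
  define f where "f s = s powr (- n)" for s :: real
  define f' where "f' s = - n * s powr (- n - 1)" for s :: real
  define f'' where "f'' s = n * (n + 1) * s powr (- n - 2)" for s :: real
  define q where "q x = (norm (x - c))\<^sup>2" for x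
  have df: "(f has_real_derivative f' s) (at s)" if "s > 0" for s
    unfolding f_def f'_def using that by (auto intro!: derivative_eq_intros)
  have df': "(f' has_real_derivative f'' s) (at s)" if "s > 0" for s
    unfolding f'_def f''_def using that
    by (auto intro!: derivative_eq_intros simp: algebra_simps)
  have Gq: "GDERIV q x :> 2 *\<^sub>R (x - c)" for x
    unfolding q_def by (rule GDERIV_norm_diff_sq)
  have Q: "((\<lambda>x. 2 *\<^sub>R (x - c)) has_derivative (\<lambda>h. 2 *\<^sub>R h)) (at x)" for x
    by (auto intro!: derivative_eq_intros)
  have fmono: "f s \<le> f t" if "0 < t" "t \<le> s" for s t
    unfolding f_def using that n by (intro powr_mono2') auto
  \<comment> \<open>The inner sphere is compact and lies in the open ball, so \<open>u\<close> stays
    below \<open>u p\<close> there by a fixed margin. This margin pays for adding the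
    barrier.\<close>
  have "\<exists>\<delta>>0. \<forall>x\<in>sphere c (R/2). u x \<le> u p - \<delta>"
  proof (cases "sphere c (R/2) = {}")
    case False
    have "continuous_on (sphere c (R/2)) u"
      using cont(1) by (rule continuous_on_subset) (use sub R in auto)
    then obtain x where x: "x \<in> sphere c (R/2)" "\<And>y. y \<in> sphere c (R/2) \<Longrightarrow> u y \<le> u x"
      using continuous_attains_sup[of "sphere c (R/2)" u] False by auto
    have "u x < u p" using x(1) R by (intro less) auto
    then show ?thesis using x(2) by (intro exI[of _ "u p - u x"]) auto
  qed (auto intro: exI[of _ 1])
  then obtain \<delta> where \<delta>: "\<delta> > 0" "\<And>x. x \<in> sphere c (R/2) \<Longrightarrow> u x \<le> u p - \<delta>" by auto
  \<comment> \<open>Adding 1 keeps the denominator positive and still leaves the barrier at most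
    \<delta> on the inner sphere.\<close>
  define \<epsilon> where "\<epsilon> = \<delta> / (f ((R/2)\<^sup>2) + 1)"
  have fpos: "f ((R/2)\<^sup>2) \<ge> 0" by (simp add: f_def)
  have \<epsilon>: "\<epsilon> > 0" "\<epsilon> * f ((R/2)\<^sup>2) \<le> \<delta>"
    using \<delta>(1) fpos by (auto simp: \<epsilon>_def field_simps)
  define \<phi> where "\<phi> x = \<epsilon> * f (q x)" for x
  define D\<phi> where "D\<phi> x = (\<epsilon> * f' (q x)) *\<^sub>R (2 *\<^sub>R (x - c))" for x
  have qpos: "q x > 0" if "x \<noteq> c" for x using that by (simp add: q_def)
  have G: "GDERIV \<phi> x :> D\<phi> x" if "x \<noteq> c" for x
    unfolding \<phi>_def D\<phi>_def
    by (rule GDERIV_compose_real[where f="\<lambda>s. \<epsilon> * f s" and f'="\<lambda>s. \<epsilon> * f' s" and q=q and Dq="\<lambda>x. 2 *\<^sub>R (x - c)"])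
       (use Gq df[OF qpos[OF that]] in \<open>auto intro!: derivative_eq_intros\<close>)
  have H: "\<exists>H. (D\<phi> has_derivative H) (at x) \<and> (\<Sum>b\<in>Basis. H b \<bullet> b) > 0" if "x \<noteq> c" for x
  proof (intro exI conjI)
    let ?H = "\<lambda>h. (\<epsilon> * f' (q x)) *\<^sub>R (2 *\<^sub>R h) +
        (\<epsilon> * f'' (q x) * (h \<bullet> (2 *\<^sub>R (x - c)))) *\<^sub>R (2 *\<^sub>R (x - c))"
    show "(D\<phi> has_derivative ?H) (at x)"
      unfolding D\<phi>_def
      by (rule gradient_compose_real_has_derivative[where f'="\<lambda>s. \<epsilon> * f' s" and f''="\<lambda>s. \<epsilon> * f'' s" and q=q and Dq="\<lambda>x. 2 *\<^sub>R (x - c)"])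
         (use Gq Q df'[OF qpos[OF that]] in \<open>auto intro!: derivative_eq_intros\<close>)
    have "(\<Sum>b\<in>Basis. ?H b \<bullet> b) = \<epsilon> * f' (q x) * (2 * n) + \<epsilon> * f'' (q x) * (4 * q x)"
      unfolding trace_compose_real by (simp add: n_def q_def power_mult_distrib)
    also have "\<dots> = \<epsilon> * (n * (2 * n + 4)) * q x powr (- n - 1)"
    proof -
      have "q x powr (- n - 1) = q x powr (- n - 2 + 1)"
        by (rule arg_cong[where f="(powr) (q x)"]) simp
      also have "\<dots> = q x powr (- n - 2) * q x"
        using qpos[OF that] by (subst powr_add) simp
      finally show ?thesis by (simp add: f'_def f''_def algebra_simps)
    qed
    also have "\<dots> > 0" using \<epsilon>(1) n qpos[OF that] by simp
    finally show "(\<Sum>b\<in>Basis. ?H b \<bullet> b) > 0" .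
  qed
  define w where "w x = u x + \<phi> x" for x
  define A where "A = cball c R - ball c (R/2)"
  have Ac: "c \<notin> A" using R by (simp add: A_def)
  have cont\<phi>: "continuous_on (- {c}) \<phi>" "continuous_on (- {c}) D\<phi>"
    using G H unfolding gderiv_def
    by (intro continuous_at_imp_continuous_on ballI; force dest: has_derivative_continuous)+
  have contA: "continuous_on A w"
    unfolding w_def
    by (intro continuous_on_add continuous_on_subset[OF cont(1)] continuous_on_subset[OF cont\<phi>(1)])
       (use Ac sub in \<open>auto simp: A_def\<close>)
  have qp: "q p = R\<^sup>2" using p by (simp add: q_def dist_norm norm_minus_commute)
  \<comment> \<open>A larger value would be attained somewhere in the annulus. The outer sphere is
    excluded since \<phi> is constant there, the inner sphere by the margin \<delta>, and the open
    annulus by strict subharmonicity of \<phi>.\<close>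
  have wA: "w x \<le> w p" if "x \<in> A" for x
  proof (rule ccontr)
    assume c: "\<not> w x \<le> w p"
    have "compact A" "A \<noteq> {}" using that by (auto simp: A_def intro: compact_diff)
    then obtain y where y: "y \<in> A" "\<And>z. z \<in> A \<Longrightarrow> w z \<le> w y"
      using continuous_attains_sup[of A w] contA by blast
    have wy: "w y > w p" using c y(2)[OF that] by simp
    have yc: "y \<noteq> c" using y Ac by auto
    have y1: "dist c y \<noteq> R"
    proof
      assume "dist c y = R"
      then have "q y = q p" "y \<in> cball c R"
        using qp by (auto simp: q_def dist_norm norm_minus_commute)
      with le[of y] wy show False by (simp add: w_def \<phi>_def)
    qed
    have y2: "dist c y \<noteq> R/2"
    proof
      assume *: "dist c y = R/2"
      then have "q y = (R/2)\<^sup>2" by (metis dist_commute dist_norm q_def)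
      then have "w y \<le> u p - \<delta> + \<epsilon> * f ((R/2)\<^sup>2)"
        using \<delta>(2)[of y] * by (simp add: w_def \<phi>_def)
      also have "\<dots> \<le> u p" using \<epsilon> by simp
      also have "\<dots> \<le> w p" using \<epsilon>(1) by (simp add: w_def \<phi>_def f_def)
      finally show False using wy by simp
    qed
    define V where "V = ball c R - cball c (R/2)"
    have V: "open V" "V \<subseteq> U" "y \<in> V"
      using y(1) y1 y2 sub by (auto simp: V_def A_def)
    have Vc: "z \<noteq> c" if "z \<in> V" for z using that R by (auto simp: V_def)
    obtain K where K: "(D\<phi> has_derivative K) (at y)" "(\<Sum>b\<in>Basis. K b \<bullet> b) > 0"
      using H[OF yc] by blast
    have "\<exists>z\<in>V. u z + \<phi> z > u y + \<phi> y"
      by (rule harmonic_plus_strict_subharmonic_no_max[OF u V G[OF Vc] K])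
    then obtain z where "z \<in> V" "w z > w y" by (auto simp: w_def)
    moreover have "V \<subseteq> A" by (auto simp: V_def A_def)
    ultimately show False using y(2)[of z] by fastforce
  qed
  have pA: "p \<in> A" using p R by (simp add: A_def)
  then have pc: "p \<noteq> c" using Ac by auto
  have seg: "\<forall>\<^sub>F t in at_right 0. p + t *\<^sub>R (c - p) \<in> ball c R - cball c (R/2)"
  proof -
    have "\<forall>\<^sub>F t in at_right 0. 0 < t \<and> t < (1/2::real)"
      by (auto simp: eventually_at_right_field intro!: exI[of _ "1/2"])
    then show ?thesis
    proof eventually_elim
      case (elim t)
      have "dist c (p + t *\<^sub>R (c - p)) = norm ((1 - t) *\<^sub>R (c - p))"
        by (simp add: dist_norm algebra_simps)
      also have "\<dots> = (1 - t) * R" using p elim by (simp add: dist_norm)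
      finally have d: "dist c (p + t *\<^sub>R (c - p)) = (1 - t) * R" .
      have "1/2 * R < (1 - t) * R" "(1 - t) * R < 1 * R"
        using elim R by (intro mult_strict_right_mono; simp)+
      then show ?case unfolding Diff_iff mem_ball mem_cball d by linarith
    qed
  qed
  \<comment> \<open>The barrier increases strictly in the inward direction \<open>c - p\<close>, so
    \<open>u\<close> itself has to decrease strictly in it.\<close>
  have *: "(Du p + D\<phi> p) \<bullet> (c - p) \<le> 0"
  proof (rule one_sided_derivative_nonpos[OF seg, where S="A" and w=w and Dw="\<lambda>x. Du x + D\<phi> x"])
    show "ball c R - cball c (R/2) \<subseteq> A" by (auto simp: A_def)
    show "p \<in> A" by (rule pA)
    show "GDERIV w x :> Du x + D\<phi> x" if "x \<in> ball c R - cball c (R/2)" for x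
      unfolding w_def using that u sub R
      by (intro GDERIV_add G) (auto simp: harmonic_gradient_def)
    show "continuous (at p within A) w"
      using contA pA by (simp add: continuous_on_eq_continuous_within)
    have "continuous_on A (\<lambda>x. Du x + D\<phi> x)"
      by (intro continuous_on_add continuous_on_subset[OF cont(2)] continuous_on_subset[OF cont\<phi>(2)])
         (use Ac sub in \<open>auto simp: A_def\<close>)
    then show "continuous (at p within A) (\<lambda>x. Du x + D\<phi> x)"
      using pA by (simp add: continuous_on_eq_continuous_within)
    show "\<forall>\<^sub>F t in at_right 0. w (p + t *\<^sub>R (c - p)) \<le> w p"
      using seg by eventually_elim (rule wA, auto simp: A_def)
  qed
  have "D\<phi> p \<bullet> (c - p) = - (\<epsilon> * f' (q p) * 2) * ((p - c) \<bullet> (p - c))"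
    by (simp add: D\<phi>_def inner_diff_left inner_diff_right inner_commute algebra_simps)
  also have "\<dots> > 0"
  proof -
    have "f' (q p) < 0" using n qpos[OF pc] by (simp add: f'_def)
    then have "\<epsilon> * f' (q p) * 2 < 0" using \<epsilon>(1) by (simp add: mult_pos_neg)
    then show ?thesis using pc by (simp add: mult_neg_pos)
  qed
  finally show ?thesis using * by (simp add: inner_add_left inner_diff_right)
qed

text \<open>The set \<open>F\<close> of maximum points is relatively closed; Hopf's lemma makes it
  open. Around a nearby point \<open>y\<close> outside \<open>F\<close>, the largest ball missing
  \<open>F\<close> touches \<open>F\<close> at some \<open>p\<close>, where Hopf's lemma gives a
  nonzero gradient although \<open>p\<close> is an interior maximum.\<close>

lemma harmonic_strong_maximum_principle:
  fixes u :: "'a::euclidean_space \<Rightarrow> real"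
  assumes u: "harmonic_gradient U u Du" and conn: "connected U"
    and x0: "x0 \<in> U" and max: "\<And>x. x \<in> U \<Longrightarrow> u x \<le> u x0"
    and x: "x \<in> U"
  shows "u x = u x0"
proof -
  have U: "open U" and G: "\<And>x. x \<in> U \<Longrightarrow> GDERIV u x :> Du x"
    using u by (auto simp: harmonic_gradient_def)
  have contu: "continuous_on U u"
    using G unfolding gderiv_def
    by (intro continuous_at_imp_continuous_on ballI) (meson has_derivative_continuous)
  have contDu: "continuous_on U Du"
    using u unfolding harmonic_gradient_def
    by (intro continuous_at_imp_continuous_on ballI) (meson has_derivative_continuous)
  define F where "F = {x \<in> U. u x = u x0}"
  have "\<exists>e>0. ball z e \<subseteq> F" if z: "z \<in> F" for z
  proof -
    have uz: "u z = u x0" "z \<in> U" using z by (auto simp: F_def)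
    obtain e where e: "e > 0" "cball z e \<subseteq> U"
      using U uz open_contains_cball by blast
    \<comment> \<open>Half the radius suffices: the touching ball about \<open>y\<close> has radius
      at most \<open>dist z y\<close>, which is below \<open>e/2\<close>, so it stays inside
      \<open>cball z e\<close>.\<close>
    have "u y = u x0" if y: "y \<in> ball z (e/2)" for y
    proof (rule ccontr)
      assume ne: "u y \<noteq> u x0"
      define K where "K = {x \<in> cball z e. u x = u x0}"
      have "closed K"
        unfolding K_def
        by (intro continuous_closed_preimage_constant continuous_on_subset[OF contu] e(2)) auto
      moreover have "z \<in> K" using uz e by (simp add: K_def)
      ultimately obtain p where p: "p \<in> K" "\<And>x. x \<in> K \<Longrightarrow> dist y p \<le> dist y x"
        using distance_attains_inf[of K y] by blast
      have ye: "dist z y < e/2" using y by simp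
      have R: "dist y p \<le> dist z y" using p(2)[OF \<open>z \<in> K\<close>] by (simp add: dist_commute)
      have cb: "cball y (dist y p) \<subseteq> cball z e"
      proof
        fix x assume "x \<in> cball y (dist y p)"
        then have "dist z x \<le> dist z y + dist y p" using dist_triangle[of z x y] by simp
        then show "x \<in> cball z e" using R ye by simp
      qed
      have pU: "p \<in> U" "u p = u x0" using p(1) e(2) by (auto simp: K_def)
      have "Du p \<bullet> (p - y) > 0"
      proof (rule hopf_ball[OF u _ _ contu contDu])
        show "cball y (dist y p) \<subseteq> U" using cb e(2) by blast
        then show "ball y (dist y p) \<subseteq> U" using ball_subset_cball by blast
        show "0 < dist y p" using ne pU by auto
        show "u x < u p" if "x \<in> ball y (dist y p)" for x
        proof -
          have "x \<in> cball y (dist y p)" using that by simp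
          then have "x \<in> cball z e" using cb by blast
          moreover have "x \<notin> K" using p(2)[of x] that by auto
          ultimately have "u x \<noteq> u x0" "x \<in> U" using e(2) by (auto simp: K_def)
          then show ?thesis using max[of x] pU by simp
        qed
        show "u x \<le> u p" if "x \<in> cball y (dist y p)" for x
          using subsetD[OF cb that] e(2) max[of x] pU by auto
      qed simp
      moreover have "Du p = 0"
        by (rule gradient_zero_at_max[OF U pU(1) G[OF pU(1)]]) (use max pU in auto)
      ultimately show False by simp
    qed
    moreover have "ball z (e/2) \<subseteq> U" using e by auto
    ultimately show ?thesis using e(1) by (intro exI[of _ "e/2"]) (auto simp: F_def)
  qed
  then have "open F" by (simp add: open_contains_ball)
  then have "openin (top_of_set U) F"
    using U by (auto simp: F_def openin_open_eq)
  moreover have "closedin (top_of_set U) F"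
    unfolding F_def by (rule continuous_closedin_preimage_constant[OF contu])
  ultimately have "F = {} \<or> F = U"
    using conn by (auto simp: connected_clopen)
  then show ?thesis using x x0 by (auto simp: F_def)
qed

subsection \<open>Local geometry of C2 domains\<close>

text \<open>Turns the graph into a defining function with gradient \<open>D\<close>. The Hessian is
  bounded on the compact ball, hence \<open>D\<close> is Lipschitz there. The pair \<open>e\<close>,
  \<gamma> is also a chart at every frontier point in the ball, so all these normals are given by
  the same \<open>D\<close>.\<close>

lemma C2_graph_near_chart:
  assumes graph: "C2_graph_near \<Omega> p e \<gamma>" and p: "p \<in> frontier \<Omega>"
  shows "\<exists>r B D. r > 0 \<and> B > 0 \<and>
     (\<forall>x. GDERIV (\<lambda>x. \<gamma> x - x \<bullet> e) x :> D x) \<and>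
     (\<forall>x\<in>ball p r. \<forall>y\<in>ball p r. norm (D x - D y) \<le> B * norm (x - y)) \<and>
     (\<Omega> \<inter> ball p r = {x \<in> ball p r. \<gamma> x - x \<bullet> e < 0}) \<and>
     (\<forall>x\<in>frontier \<Omega> \<inter> ball p r. \<gamma> x - x \<bullet> e = 0 \<and> D x \<noteq> 0 \<and> outward_normal \<Omega> x = sgn (D x))"
proof -
  obtain r where r: "r > 0" "\<Omega> \<inter> ball p r = {x \<in> ball p r. x \<bullet> e > \<gamma> x}"
    and C2: "norm e = 1" "C2_on \<gamma> UNIV" "\<forall>x t. \<gamma> (x + t *\<^sub>R e) = \<gamma> x"
    using graph unfolding C2_graph_near_def by blast
  obtain Dg D2 where G: "\<And>x. GDERIV \<gamma> x :> Dg x"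
    and D2: "\<And>x. (Dg has_derivative blinfun_apply (D2 x)) (at x)" "continuous_on UNIV D2"
    using C2(2) by (auto simp: C2_on_def)
  define D where "D x = Dg x - e" for x
  have "compact (D2 ` cball p r)"
    by (intro compact_continuous_image continuous_on_subset[OF D2(2)]) auto
  then have "bounded (D2 ` cball p r)" by (rule compact_imp_bounded)
  then obtain B where B: "B > 0" "\<forall>y\<in>D2 ` cball p r. norm y \<le> B"
    unfolding bounded_pos by blast
  have lip: "norm (D x - D y) \<le> B * norm (x - y)" if "x \<in> ball p r" "y \<in> ball p r" for x y
  proof -
    have "norm (Dg x - Dg y) \<le> B * norm (x - y)"
    proof (rule differentiable_bound[OF convex_ball[of p r]])
      show "(Dg has_derivative blinfun_apply (D2 z)) (at z within ball p r)" for z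
        using D2(1) by (rule has_derivative_at_withinI)
      show "onorm (blinfun_apply (D2 z)) \<le> B" if "z \<in> ball p r" for z
        using B(2) that by (simp add: norm_blinfun.rep_eq)
    qed (use that in auto)
    then show ?thesis by (simp add: D_def)
  qed
  have GD: "GDERIV (\<lambda>x. \<gamma> x - x \<bullet> e) x :> D x" for x
    using G unfolding gderiv_def D_def
    by (auto intro!: derivative_eq_intros simp: inner_diff_right)
  have fr: "\<gamma> x - x \<bullet> e = 0 \<and> D x \<noteq> 0 \<and> outward_normal \<Omega> x = sgn (D x)"
    if x: "x \<in> frontier \<Omega>" "x \<in> ball p r" for x
  proof -
    have sub: "ball x (r - dist p x) \<subseteq> ball p r"
    proof
      fix y assume "y \<in> ball x (r - dist p x)"
      then show "y \<in> ball p r" using dist_triangle[of p y x] by simp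
    qed
    have "\<Omega> \<inter> ball x (r - dist p x) = (\<Omega> \<inter> ball p r) \<inter> ball x (r - dist p x)"
      using sub by blast
    also have "\<dots> = {y \<in> ball x (r - dist p x). y \<bullet> e > \<gamma> y}"
      unfolding r(2) using sub by blast
    finally have gx: "C2_graph_near \<Omega> x e \<gamma>"
      unfolding C2_graph_near_def using C2 x(2)
      by (intro conjI exI[of _ "r - dist p x"]) auto
    then have n: "has_outward_normal \<Omega> x (sgn (D x))"
      unfolding has_outward_normal_def D_def using G by blast
    then have "outward_normal \<Omega> x = sgn (D x)"
      unfolding outward_normal_def
      by (rule the_equality) (use n has_outward_normal_unique x(1) in blast)
    moreover have "D x \<noteq> 0"
      using has_outward_normal_norm[OF n] by auto
    ultimately show ?thesis
      using C2_graph_near_frontier[OF gx x(1)] by simp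
  qed
  show ?thesis
    using r B(1) lip GD fr
    by (intro exI[of _ r] exI[of _ B] exI[of _ D] conjI) auto
qed

lemma Lipschitz_gradient_taylor:
  fixes \<rho> :: "'a::euclidean_space \<Rightarrow> real"
  assumes G: "\<And>x. GDERIV \<rho> x :> D x"
    and lip: "\<And>x y. x \<in> ball p r \<Longrightarrow> y \<in> ball p r \<Longrightarrow> norm (D x - D y) \<le> B * norm (x - y)"
    and B: "B > 0" and xy: "x \<in> ball p r" "y \<in> ball p r"
  shows "\<bar>\<rho> y - \<rho> x - D x \<bullet> (y - x)\<bar> \<le> B * (norm (y - x))\<^sup>2"
proof -
  define h where "h = y - x"
  have "\<exists>t. 0 < t \<and> t < 1 \<and> \<rho> (x + 1 *\<^sub>R h) - \<rho> (x + 0 *\<^sub>R h) = (1 - 0) * (D (x + t *\<^sub>R h) \<bullet> h)"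
    by (rule MVT2[where f="\<lambda>t. \<rho> (x + t *\<^sub>R h)" and f'="\<lambda>t. D (x + t *\<^sub>R h) \<bullet> h"])
       (use G in \<open>auto intro: GDERIV_line\<close>)
  then obtain t where t: "0 < t" "t < 1" "\<rho> y - \<rho> x = D (x + t *\<^sub>R h) \<bullet> h"
    by (auto simp: h_def)
  have "(1 - t) *\<^sub>R x + t *\<^sub>R y \<in> ball p r"
    using xy t by (intro convexD_alt convex_ball) auto
  then have "x + t *\<^sub>R h \<in> ball p r" by (simp add: h_def algebra_simps)
  then have "norm (D (x + t *\<^sub>R h) - D x) \<le> B * norm (t *\<^sub>R h)"
    using lip[of "x + t *\<^sub>R h" x] xy by simp
  also have "\<dots> \<le> B * norm h" using t B by (simp add: mult_le_cancel_right1 mult_left_le_one_le)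
  finally have "norm (D (x + t *\<^sub>R h) - D x) * norm h \<le> B * norm h * norm h"
    by (rule mult_right_mono) simp
  moreover have "\<bar>(D (x + t *\<^sub>R h) - D x) \<bullet> h\<bar> \<le> norm (D (x + t *\<^sub>R h) - D x) * norm h"
    by (rule Cauchy_Schwarz_ineq2)
  moreover have "\<rho> y - \<rho> x - D x \<bullet> (y - x) = (D (x + t *\<^sub>R h) - D x) \<bullet> h"
    using t(3) by (simp add: h_def inner_diff_left)
  ultimately show ?thesis by (simp add: h_def power2_eq_square mult.assoc)
qed

text \<open>Write \<open>h = x - p\<close>. In the tangent ball, |h|^2 + 2 R (\<nu> . h) \<le> 0, so
  the linear term of the defining function is at most - L |h|^2 / (2 R). For small \<open>R\<close>
  it outweighs the Taylor error B |h|^2.\<close>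

lemma C2_domain_interior_ball:
  assumes dom: "C2_domain \<Omega>" and p: "p \<in> frontier \<Omega>" and s: "s > 0"
  shows "\<exists>R>0. R < s \<and> cball (p - R *\<^sub>R outward_normal \<Omega> p) R - {p} \<subseteq> \<Omega>"
proof -
  obtain e \<gamma> where "C2_graph_near \<Omega> p e \<gamma>"
    using dom p unfolding C2_domain_def by blast
  from C2_graph_near_chart[OF this p] obtain r B D where r: "r > 0" "B > 0"
    and G: "\<And>x. GDERIV (\<lambda>x. \<gamma> x - x \<bullet> e) x :> D x"
    and lip: "\<And>x y. x \<in> ball p r \<Longrightarrow> y \<in> ball p r \<Longrightarrow> norm (D x - D y) \<le> B * norm (x - y)"
    and \<Omega>: "\<Omega> \<inter> ball p r = {x \<in> ball p r. \<gamma> x - x \<bullet> e < 0}"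
    and fr: "\<And>x. x \<in> frontier \<Omega> \<inter> ball p r \<Longrightarrow>
        \<gamma> x - x \<bullet> e = 0 \<and> D x \<noteq> 0 \<and> outward_normal \<Omega> x = sgn (D x)"
    by blast
  define \<nu> where "\<nu> = outward_normal \<Omega> p"
  have pr: "p \<in> frontier \<Omega> \<inter> ball p r" using p r by simp
  define L where "L = norm (D p)"
  have L: "L > 0" "D p = L *\<^sub>R \<nu>" "norm \<nu> = 1"
    using fr[OF pr] by (auto simp: L_def \<nu>_def sgn_div_norm)
  \<comment> \<open>The bound \<open>s/2\<close> ensures \<open>R < s\<close>, \<open>r/4\<close>
    keeps the ball inside the chart, and \<open>L / (4 * B)\<close> gives 2 R B \<le> L/2 <
    L.\<close>
  define R where "R = min (s/2) (min (r/4) (L / (4 * B)))"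
  have R: "R > 0" "R < s" "4 * R \<le> r" "R * (4 * B) \<le> L"
  proof -
    show "R > 0" using s r L by (simp add: R_def)
    show "R < s" "4 * R \<le> r" using s by (simp_all add: R_def min_def)
    have "R \<le> L / (4 * B)" by (simp add: R_def)
    then show "R * (4 * B) \<le> L" using r by (simp add: pos_le_divide_eq)
  qed
  have "x \<in> \<Omega>" if x: "x \<in> cball (p - R *\<^sub>R \<nu>) R" "x \<noteq> p" for x
  proof -
    define h where "h = x - p"
    have h0: "norm h > 0" using x by (simp add: h_def)
    have "norm (h + R *\<^sub>R \<nu>) \<le> R"
      using x(1) by (simp add: h_def dist_norm norm_minus_commute algebra_simps)
    then have le: "(norm (h + R *\<^sub>R \<nu>))\<^sup>2 \<le> R\<^sup>2" by (rule power_mono) simp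
    have "(norm (h + R *\<^sub>R \<nu>))\<^sup>2 = (norm h)\<^sup>2 + 2 * R * (\<nu> \<bullet> h) + R\<^sup>2 * (norm \<nu>)\<^sup>2"
      unfolding power2_norm_eq_inner
      by (simp add: inner_add_left inner_add_right inner_commute algebra_simps power2_eq_square)
    with le L have hn: "(norm h)\<^sup>2 + 2 * R * (\<nu> \<bullet> h) \<le> 0" by simp
    have "norm h \<le> norm (h + R *\<^sub>R \<nu>) + norm (R *\<^sub>R \<nu>)"
      using norm_triangle_ineq4[of "h + R *\<^sub>R \<nu>" "R *\<^sub>R \<nu>"] by simp
    then have "norm h < r" using \<open>norm (h + R *\<^sub>R \<nu>) \<le> R\<close> L(3) R by simp
    then have xr: "x \<in> ball p r" by (simp add: h_def dist_norm norm_minus_commute)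
    have "(\<gamma> x - x \<bullet> e) - D p \<bullet> h \<le> B * (norm h)\<^sup>2"
      using Lipschitz_gradient_taylor[where x=p and y=x and p=p and r=r, OF G lip r(2)] pr xr fr[OF pr] by (auto simp: h_def)
    moreover have "2 * R * (D p \<bullet> h) \<le> - L * (norm h)\<^sup>2"
      using mult_left_mono[OF hn, of L] L by (simp add: algebra_simps)
    ultimately have "2 * R * (\<gamma> x - x \<bullet> e) \<le> 2 * R * (B * (norm h)\<^sup>2) - L * (norm h)\<^sup>2"
      using R(1) mult_left_mono[of "(\<gamma> x - x \<bullet> e) - D p \<bullet> h" "B * (norm h)\<^sup>2" "2 * R"]
      by (simp add: right_diff_distrib)
    also have "\<dots> = (2 * R * B - L) * (norm h)\<^sup>2" by (simp add: algebra_simps)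
    also have "\<dots> < 0"
      using R L r h0 by (intro mult_neg_pos) (auto simp: algebra_simps)
    finally have "\<gamma> x - x \<bullet> e < 0" using R(1) by (simp add: mult_less_0_iff)
    then show "x \<in> \<Omega>" using xr \<Omega> by blast
  qed
  then show ?thesis using R unfolding \<nu>_def by blast
qed

text \<open>The defining function vanishes at both \<open>x\<close> and \<open>p\<close>, so its
  Taylor expansion at \<open>x\<close> leaves only the quadratic error for the product of the
  gradient with \<open>x - p\<close>. These are the two facts about normals that the barrier at
  \<open>0\<close> has to cope with.\<close>

lemma C2_domain_normal_near:
  assumes dom: "C2_domain \<Omega>" and p: "p \<in> frontier \<Omega>"
  shows "\<exists>r>0. \<exists>C\<ge>0. \<forall>x\<in>frontier \<Omega> \<inter> ball p r.
     \<bar>outward_normal \<Omega> x \<bullet> (x - p)\<bar> \<le> C * (norm (x - p))\<^sup>2 \<and>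
     outward_normal \<Omega> x \<bullet> outward_normal \<Omega> p \<ge> 1/2"
proof -
  obtain e \<gamma> where "C2_graph_near \<Omega> p e \<gamma>"
    using dom p unfolding C2_domain_def by blast
  from C2_graph_near_chart[OF this p] obtain r B D where r: "r > 0" "B > 0"
    and G: "\<And>x. GDERIV (\<lambda>x. \<gamma> x - x \<bullet> e) x :> D x"
    and lip: "\<And>x y. x \<in> ball p r \<Longrightarrow> y \<in> ball p r \<Longrightarrow> norm (D x - D y) \<le> B * norm (x - y)"
    and fr: "\<And>x. x \<in> frontier \<Omega> \<inter> ball p r \<Longrightarrow>
        \<gamma> x - x \<bullet> e = 0 \<and> D x \<noteq> 0 \<and> outward_normal \<Omega> x = sgn (D x)"
    by blast
  have pr: "p \<in> frontier \<Omega> \<inter> ball p r" using p r by simp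
  define L where "L = norm (D p)"
  have L: "L > 0" using fr[OF pr] by (simp add: L_def)
  \<comment> \<open>The gradient then varies by at most \<open>L/4\<close>, so its norm lies between
    3/4 L and 5/4 L, and the normals have inner product at least (3/4)/(5/4), which exceeds
    1/2.\<close>
  define r' where "r' = min r (L / (4 * B))"
  have r': "r' > 0" using r L by (simp add: r'_def)
  have "\<bar>outward_normal \<Omega> x \<bullet> (x - p)\<bar> \<le> (2 * B / L) * (norm (x - p))\<^sup>2 \<and>
     outward_normal \<Omega> x \<bullet> outward_normal \<Omega> p \<ge> 1/2"
    if x: "x \<in> frontier \<Omega>" "x \<in> ball p r'" for x
  proof -
    have xr: "x \<in> frontier \<Omega> \<inter> ball p r" and xd: "norm (x - p) < L / (4 * B)"
      using x by (auto simp: r'_def dist_norm norm_minus_commute)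
    have d: "norm (D x - D p) \<le> L / 4"
    proof -
      have "norm (D x - D p) \<le> B * norm (x - p)" using lip xr pr by blast
      also have "\<dots> \<le> B * (L / (4 * B))" using xd r by (intro mult_left_mono) auto
      finally show ?thesis using r by simp
    qed
    have n1: "norm (D x) \<ge> 3/4 * L"
      using norm_triangle_ineq2[of "D p" "D x"] d by (simp add: L_def norm_minus_commute)
    have n2: "norm (D x) \<le> 5/4 * L"
      using norm_triangle_ineq2[of "D x" "D p"] d by (simp add: L_def)
    have nx: "outward_normal \<Omega> x = D x /\<^sub>R norm (D x)" "outward_normal \<Omega> p = D p /\<^sub>R L"
      using fr[OF xr] fr[OF pr] by (auto simp: sgn_div_norm L_def)
    have "\<bar>D x \<bullet> (x - p)\<bar> \<le> B * (norm (x - p))\<^sup>2"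
      using Lipschitz_gradient_taylor[where x=x and y=p and p=p and r=r, OF G lip r(2)] pr xr fr[OF pr] fr[OF xr]
      by (auto simp: inner_diff_right norm_minus_commute)
    then have "\<bar>D x \<bullet> (x - p)\<bar> / norm (D x) \<le> B * (norm (x - p))\<^sup>2 / (L / 2)"
      using n1 L r by (intro frac_le) auto
    moreover have "outward_normal \<Omega> x \<bullet> (x - p) = (D x \<bullet> (x - p)) / norm (D x)"
      unfolding nx inner_scaleR_left by (simp only: divide_inverse mult.commute)
    moreover have "B * (norm (x - p))\<^sup>2 / (L / 2) = (2 * B / L) * (norm (x - p))\<^sup>2"
      by (simp add: field_simps)
    ultimately have 1: "\<bar>outward_normal \<Omega> x \<bullet> (x - p)\<bar> \<le> (2 * B / L) * (norm (x - p))\<^sup>2"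
      by (simp only: abs_divide abs_norm_cancel)
    have "(D x - D p) \<bullet> D p \<ge> - (L/4 * L)"
    proof -
      have "\<bar>(D x - D p) \<bullet> D p\<bar> \<le> norm (D x - D p) * L"
        unfolding L_def by (rule Cauchy_Schwarz_ineq2)
      also have "\<dots> \<le> L/4 * L" using d L by (intro mult_right_mono) auto
      finally show ?thesis by simp
    qed
    moreover have "D p \<bullet> D p = L * L"
      unfolding L_def power2_eq_square[symmetric] power2_norm_eq_inner ..
    ultimately have "D x \<bullet> D p \<ge> 3/4 * L * L" by (simp add: inner_diff_left)
    moreover have "norm (D x) * L / 2 \<le> 5/4 * L * L / 2"
      using n2 L by (intro divide_right_mono mult_right_mono) auto
    moreover have "L * L > 0" using L by simp
    ultimately have "norm (D x) * L / 2 \<le> D x \<bullet> D p" by linarith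
    moreover have "norm (D x) * L > 0" using n1 L by (intro mult_pos_pos) linarith+
    ultimately have "1/2 \<le> (D x \<bullet> D p) / (norm (D x) * L)"
      by (simp add: pos_le_divide_eq)
    also have "\<dots> = outward_normal \<Omega> x \<bullet> outward_normal \<Omega> p"
      unfolding nx inner_scaleR_left inner_scaleR_right
      by (simp only: divide_inverse inverse_mult_distrib mult_ac)
    finally have "outward_normal \<Omega> x \<bullet> outward_normal \<Omega> p \<ge> 1/2" .
    with 1 show ?thesis by simp
  qed
  then show ?thesis using r' r L
    by (intro exI[of _ r'] conjI exI[of _ "2 * B / L"]) auto
qed

subsection \<open>A barrier at the singular point\<close>

text \<open>The fundamental solution up to a constant factor, with the sign that makes it positive
  near \<open>0\<close>; for \<open>n = 2\<close> this holds only for \<open>t < 1\<close>.\<close>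

definition fundamental_growth :: "nat \<Rightarrow> real \<Rightarrow> real" where
  "fundamental_growth n t = (if n = 2 then - ln t else t powr (2 - real n))"

text \<open>Here \<open>s\<close> stands for a perturbed squared norm. The first term of the
  derivative integrates to the fundamental solution, the second is the correction that produces
  strictness. The range \<open>s \<le> 2 * t\<^sup>2\<close> leaves room for the
  perturbation.\<close>

lemma barrier_profile:
  assumes n: "n \<ge> 2"
  shows "\<exists>f r c. r > 0 \<and> c > 0 \<and>
    (\<forall>s>0. (f has_real_derivative - (s powr (- real n / 2)) - s powr (1/4 - real n / 2)) (at s)) \<and>
    (\<forall>s t. 0 < t \<and> t < r \<and> 0 < s \<and> s \<le> 2 * t\<^sup>2 \<longrightarrow>
       fundamental_growth n t > 0 \<and> f s \<ge> c * fundamental_growth n t)"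
proof (cases "n = 2")
  case True
  define f where "f s = - ln s - 4 * s powr (1/4)" for s :: real
  have "(f has_real_derivative - (s powr (- real n / 2)) - s powr (1/4 - real n / 2)) (at s)"
    if "s > 0" for s
    unfolding f_def using that
    by (auto intro!: derivative_eq_intros simp: True powr_minus field_simps)
  moreover have "fundamental_growth n t > 0 \<and> f s \<ge> 1 * fundamental_growth n t"
    \<comment> \<open>The bounds below give f s \<ge> - 2 ln t - 1 - 4, and this is at least - ln t
      as soon as ln t \<le> - 5.\<close>
    if t: "0 < t" "t < exp (- 5)" and s: "0 < s" "s \<le> 2 * t\<^sup>2" for s t
  proof -
    have lt: "ln t < - 5" using t by (metis exp_gt_zero ln_exp ln_less_cancel_iff)
    have "t < 1" using t(2) exp_less_one_iff[of "-5::real"] by linarith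
    have "ln s \<le> ln (2 * t\<^sup>2)" using s t by simp
    also have "\<dots> = ln 2 + 2 * ln t" using t by (simp add: ln_mult ln_realpow)
    also have "\<dots> \<le> 1 + 2 * ln t" using ln_2_less_1 by simp
    finally have ls: "ln s \<le> 1 + 2 * ln t" .
    then have "ln s \<le> 0" using lt by simp
    then have "s \<le> 1" using s by simp
    then have "s powr (1/4) \<le> 1" using s by (intro powr_le1) auto
    then show ?thesis using lt ls by (simp add: f_def fundamental_growth_def True)
  qed
  ultimately show ?thesis
    by (intro exI[of _ f] exI[of _ "exp (- 5)"] exI[of _ 1]) auto
next
  case False
  define a where "a = real n / 2"
  have a: "a \<ge> 3/2" using n False by (simp add: a_def)
  define f where "f s = s powr (1 - a) / (a - 1) + s powr (5/4 - a) / (a - 5/4)" for s :: real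
  have df: "(f has_real_derivative - (s powr (- real n / 2)) - s powr (1/4 - real n / 2)) (at s)"
    if "s > 0" for s
  proof -
    have "(f has_real_derivative (1 - a) * s powr (1 - a - 1) / (a - 1)
        + (5/4 - a) * s powr (5/4 - a - 1) / (a - 5/4)) (at s)"
      unfolding f_def using that a by (auto intro!: derivative_eq_intros)
    moreover have "(1 - a) * s powr (1 - a - 1) / (a - 1) = - (s powr (- real n / 2))"
      using a by (simp add: field_simps a_def)
    moreover have "(5/4 - a) * s powr (5/4 - a - 1) / (a - 5/4) = - (s powr (1/4 - real n / 2))"
    proof -
      have "5/4 - a - 1 = 1/4 - real n / 2" by (simp add: a_def)
      moreover have "(5/4 - a) / (a - 5/4) = - 1" using a by (simp add: field_simps)
      ultimately show ?thesis by (metis mult_minus1 times_divide_eq_left mult.commute)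
    qed
    ultimately show ?thesis by simp
  qed
  define c where "c = 2 powr (1 - a) / (a - 1)"
  have c: "c > 0" using a by (simp add: c_def)
  have "fundamental_growth n t > 0 \<and> f s \<ge> c * fundamental_growth n t"
    if t: "0 < t" "t < 1" and s: "0 < s" "s \<le> 2 * t\<^sup>2" for s t
  proof -
    have "(t\<^sup>2) powr (1 - a) = t powr (2 - real n)"
    proof -
      have "(t\<^sup>2) powr (1 - a) = t powr (2 * (1 - a))"
        using t powr_powr[of t 2 "1 - a"] by simp
      then show ?thesis by (simp add: a_def algebra_simps)
    qed
    then have "c * t powr (2 - real n) = (2 * t\<^sup>2) powr (1 - a) / (a - 1)"
      by (simp add: c_def powr_mult)
    also have "\<dots> \<le> s powr (1 - a) / (a - 1)"
      using a s t by (intro divide_right_mono powr_mono2') auto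
    also have "\<dots> \<le> f s" using a by (simp add: f_def)
    finally show ?thesis using t False by (simp add: fundamental_growth_def)
  qed
  then show ?thesis using df c
    by (intro exI[of _ f] exI[of _ 1] exI[of _ c]) auto
qed

text \<open>The barrier is \<open>\<Phi> = f (q x)\<close> with \<open>q x = \<bar>x\<bar>\<^sup>2 (1 - K x \<bullet> m)\<close> and \<open>f\<close> from \<open>barrier_profile\<close>.
  The tilt \<open>K x \<bullet> m\<close> gives \<open>q\<close> a normal derivative of order \<open>- K \<bar>x\<bar>\<^sup>2\<close>, which beats the contribution
  \<open>C \<bar>x\<bar>\<^sup>2\<close> of the curvature of the boundary. The tilt perturbs the Laplacian by a relative error
  of order \<open>\<bar>x\<bar>\<close>; the lower-order term of \<open>f'\<close>, of relative size \<open>q\<close> to the power \<open>1/4\<close>, i.e.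
  of order \<open>\<bar>x\<bar>\<close> to the power \<open>1/2\<close>, absorbs it.\<close>

lemma singular_barrier:
  fixes m :: "'a::euclidean_space"
  assumes dim: "DIM('a) \<ge> 2" and m: "norm m = 1" and C: "C \<ge> 0"
  shows "\<exists>\<Phi> D\<Phi> r c. r > 0 \<and> c > 0 \<and> (\<forall>x::'a. 0 < norm x \<and> norm x < r \<longrightarrow>
     GDERIV \<Phi> x :> D\<Phi> x \<and>
     (\<exists>H. (D\<Phi> has_derivative H) (at x) \<and> (\<Sum>b\<in>Basis. H b \<bullet> b) < 0) \<and>
     fundamental_growth DIM('a) (norm x) > 0 \<and>
     \<Phi> x \<ge> c * fundamental_growth DIM('a) (norm x) \<and>
     (\<forall>\<nu>. \<bar>\<nu> \<bullet> x\<bar> \<le> C * (norm x)\<^sup>2 \<and> \<nu> \<bullet> m \<ge> 1/2 \<longrightarrow> D\<Phi> x \<bullet> \<nu> > 0))"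
proof -
  \<comment> \<open>Chosen so that the normal derivative of \<open>q\<close>, at most (3 C - K/2)
    |x|^2, equals at most - (C + 1/2) |x|^2.\<close>
  define K where "K = 8 * C + 1"
  have K: "K > 0" using C by (simp add: K_def)
  define a where "a = real DIM('a) / 2"
  have a: "a \<ge> 1" using dim by (simp add: a_def)
  obtain f r0 c where r0: "r0 > 0" and c: "c > 0"
    and df: "\<And>s. s > 0 \<Longrightarrow> (f has_real_derivative - (s powr (- a)) - s powr (1/4 - a)) (at s)"
    and fg: "\<And>s t. 0 < t \<Longrightarrow> t < r0 \<Longrightarrow> 0 < s \<Longrightarrow> s \<le> 2 * t\<^sup>2 \<Longrightarrow>
       fundamental_growth DIM('a) t > 0 \<and> f s \<ge> c * fundamental_growth DIM('a) t"
    using barrier_profile[OF dim] unfolding a_def by (metis minus_divide_left)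
  define f' where "f' s = - (s powr (- a)) - s powr (1/4 - a)" for s :: real
  define f'' where "f'' s = a * s powr (- a - 1) + (a - 1/4) * s powr (1/4 - a - 1)" for s :: real
  have df': "(f' has_real_derivative f'' s) (at s)" if "s > 0" for s
    unfolding f'_def f''_def using that
    by (auto intro!: derivative_eq_intros simp: algebra_simps)
  define q where "q x = (norm x)\<^sup>2 * (1 - K * (x \<bullet> m))" for x :: 'a
  define Dq where "Dq x = (2 * (1 - K * (x \<bullet> m))) *\<^sub>R x - (K * (norm x)\<^sup>2) *\<^sub>R m" for x :: 'a
  define Q where "Q x h = (2 * (1 - K * (x \<bullet> m))) *\<^sub>R h - (2 * K * (h \<bullet> m)) *\<^sub>R x
      - (2 * K * (x \<bullet> h)) *\<^sub>R m" for x h :: 'a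
  have Gq: "GDERIV q x :> Dq x" for x
    unfolding q_def Dq_def gderiv_def power2_norm_eq_inner
    by (auto intro!: derivative_eq_intros simp: inner_commute inner_diff_right algebra_simps)
  have DDq: "(Dq has_derivative Q x) (at x)" for x
    unfolding Dq_def Q_def power2_norm_eq_inner
    by (auto intro!: derivative_eq_intros simp: inner_commute algebra_simps)
  have trQ: "(\<Sum>b\<in>Basis. Q x b \<bullet> b) = 4 * a - (4 * a + 4) * (K * (x \<bullet> m))" for x
  proof -
    have "(\<Sum>b\<in>Basis. Q x b \<bullet> b) = (\<Sum>b\<in>(Basis::'a set). 2 * (1 - K * (x \<bullet> m)))
        - 4 * K * (\<Sum>b\<in>Basis. (x \<bullet> b) * (m \<bullet> b))"
      unfolding sum_distrib_left sum_subtractf[symmetric]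
      by (rule sum.cong) (simp_all add: Q_def inner_diff_left inner_commute[of m])
    also have "(\<Sum>b\<in>Basis. (x \<bullet> b) * (m \<bullet> b)) = x \<bullet> m"
      by (rule euclidean_inner[symmetric])
    finally show ?thesis by (simp add: a_def algebra_simps)
  qed
  have nDq: "(norm (Dq x))\<^sup>2 = 4 * q x * (1 - 2 * (K * (x \<bullet> m))) + K\<^sup>2 * (norm x)\<^sup>2 * (norm x)\<^sup>2" for x
  proof -
    have "m \<bullet> m = 1" using m by (simp add: norm_eq_1)
    then show ?thesis
      unfolding power2_norm_eq_inner Dq_def q_def
      by (simp add: inner_diff_left inner_diff_right inner_commute algebra_simps power2_eq_square)
  qed
  define \<Phi> where "\<Phi> x = f (q x)" for x
  define D\<Phi> where "D\<Phi> x = f' (q x) *\<^sub>R Dq x" for x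
  \<comment> \<open>The total error in the Laplacian: 2 (4 a + 4) from the Laplacian of
    \<open>q\<close> plus 2 a * 9 from its squared gradient, both in units of
    \<open>K * norm x\<close>.\<close>
  define A where "A = 26 * a + 8"
  have A: "A > 0" using a by (simp add: A_def)
  \<comment> \<open>In turn: \<open>r0\<close> makes the profile estimate available, 1/2 gives
    \<sigma> \<le> 1, \<open>1 / (2 * K)\<close> keeps the tilt below 1/2, and the last bound makes
    \<sigma>, of order sqrt t, exceed the error \<open>A * z\<close>, of order t.\<close>
  define r where "r = min r0 (min (1/2) (min (1 / (2 * K)) ((1 / (2 * A * K))\<^sup>2)))"
  have r: "r > 0" using r0 K A by (simp add: r_def)
  have main: "GDERIV \<Phi> x :> D\<Phi> x \<and>
     (\<exists>H. (D\<Phi> has_derivative H) (at x) \<and> (\<Sum>b\<in>Basis. H b \<bullet> b) < 0) \<and>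
     fundamental_growth DIM('a) (norm x) > 0 \<and>
     \<Phi> x \<ge> c * fundamental_growth DIM('a) (norm x) \<and>
     (\<forall>\<nu>. \<bar>\<nu> \<bullet> x\<bar> \<le> C * (norm x)\<^sup>2 \<and> \<nu> \<bullet> m \<ge> 1/2 \<longrightarrow> D\<Phi> x \<bullet> \<nu> > 0)"
    if x: "0 < norm x" "norm x < r" for x :: 'a
  proof -
    define t where "t = norm x"
    define y where "y = K * (x \<bullet> m)"
    define z where "z = K * t"
    have t: "0 < t" "t < r0" "t < 1/2" "t < 1 / (2 * K)" "t < (1 / (2 * A * K))\<^sup>2"
      using x by (auto simp: t_def r_def)
    have z: "0 < z" "z < 1/2" using t K by (auto simp: z_def field_simps)
    have yz: "\<bar>y\<bar> \<le> z"
      using Cauchy_Schwarz_ineq2[of x m] m K by (simp add: y_def z_def t_def abs_mult)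
    have qx: "q x = t\<^sup>2 * (1 - y)" by (simp add: q_def t_def y_def)
    have t2: "t\<^sup>2 > 0" using t by simp
    have q1: "q x \<ge> t\<^sup>2 / 4" unfolding qx
      using mult_left_mono[of "1/4" "1 - y" "t\<^sup>2"] yz z by simp
    have q2: "q x \<le> 2 * t\<^sup>2"
      using mult_left_mono[of "1 - y" 2 "t\<^sup>2"] yz z t2 by (simp add: qx mult.commute)
    have qpos: "q x > 0" using q1 t2 by linarith
    have tt: "t\<^sup>2 \<le> 1/4" using t power_mono[of t "1/2" 2] by (simp add: power2_eq_square)
    define P where "P = q x powr (- a)"
    define \<sigma> where "\<sigma> = q x powr (1/4)"
    have P: "P > 0" using qpos by (simp add: P_def)
    have \<sigma>1: "\<sigma> \<le> 1" unfolding \<sigma>_def using q2 qpos tt by (intro powr_le1) auto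
    have \<sigma>sqrt: "\<sigma> = sqrt (sqrt (q x))"
      using qpos by (simp add: \<sigma>_def powr_powr flip: powr_half_sqrt)
    have \<sigma>2: "\<sigma> > A * z"
    proof -
      have "t / 2 = sqrt (t\<^sup>2 / 4)" using t by (simp add: real_sqrt_divide)
      also have "\<dots> \<le> sqrt (q x)" using q1 by simp
      finally have "t / 4 \<le> sqrt (q x)" using t by simp
      then have "sqrt (t / 4) \<le> \<sigma>" unfolding \<sigma>sqrt by (rule real_sqrt_le_mono)
      then have s: "sqrt t / 2 \<le> \<sigma>" by (simp add: real_sqrt_divide)
      have "sqrt t < sqrt ((1 / (2 * A * K))\<^sup>2)" using t(5) by (rule real_sqrt_less_mono)
      also have "\<dots> = 1 / (2 * A * K)" using A K by (simp add: abs_mult)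
      finally have "sqrt t * (2 * A * K) < 1" using A K by (simp add: field_simps)
      then have "sqrt t * (sqrt t * (2 * A * K)) < sqrt t * 1"
        using t by (intro mult_strict_left_mono) auto
      moreover have "sqrt t * (sqrt t * (2 * A * K)) = 2 * (A * z)"
        using t by (simp add: z_def flip: mult.assoc)
      ultimately show ?thesis using s by simp
    qed
    have fp: "f' (q x) = - P * (1 + \<sigma>)"
      using qpos by (simp add: f'_def P_def \<sigma>_def algebra_simps flip: powr_add)
    have fpp: "f'' (q x) * q x = P * (a + (a - 1/4) * \<sigma>)"
    proof -
      have 1: "q x powr (- a - 1) * q x = P"
        using qpos powr_add[of "q x" "- a - 1" 1] by (simp add: P_def)
      have 2: "q x powr (1/4 - a - 1) * q x = P * \<sigma>"
        using qpos powr_add[of "q x" "1/4 - a - 1" 1] powr_add[of "q x" "- a" "1/4"]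
        by (simp add: P_def \<sigma>_def)
      have "f'' (q x) * q x = a * (q x powr (- a - 1) * q x) + (a - 1/4) * (q x powr (1/4 - a - 1) * q x)"
        by (simp add: f''_def algebra_simps)
      then show ?thesis unfolding 1 2 by (simp add: algebra_simps)
    qed
    \<comment> \<open>The tilt's effect on the squared gradient: without the tilt it would be
      \<open>4 * q x\<close>.\<close>
    define E where "E = - 8 * y + z\<^sup>2 / (1 - y)"
    have nD: "(norm (Dq x))\<^sup>2 = q x * (4 + E)"
    proof -
      have "1 - y \<noteq> 0" using yz z by auto
      then have "q x * (z\<^sup>2 / (1 - y)) = t\<^sup>2 * z\<^sup>2" by (simp add: qx)
      then show ?thesis
        unfolding nDq by (simp add: E_def algebra_simps z_def power_mult_distrib flip: t_def y_def)
    qed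
    have E: "E \<le> 9 * z"
    proof -
      have "z\<^sup>2 / (1 - y) \<le> z\<^sup>2 / (1/2)" using yz z by (intro divide_left_mono) auto
      also have "\<dots> = 2 * z * z" by (simp add: power2_eq_square)
      also have "\<dots> \<le> 1 * z" using z by (intro mult_right_mono) auto
      finally show ?thesis using yz by (simp add: E_def)
    qed
    have GP: "GDERIV \<Phi> x :> D\<Phi> x"
      unfolding \<Phi>_def D\<Phi>_def
      by (rule GDERIV_compose_real[where f'=f']) (use Gq df[OF qpos] in \<open>auto simp: f'_def\<close>)
    have HP: "(D\<Phi> has_derivative (\<lambda>h. f' (q x) *\<^sub>R Q x h + (f'' (q x) * (h \<bullet> Dq x)) *\<^sub>R Dq x)) (at x)"
      unfolding D\<Phi>_def
      by (rule gradient_compose_real_has_derivative[where q=q and f'=f' and f''=f'', OF Gq DDq df'[OF qpos]])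
    have "(\<Sum>b\<in>Basis. (f' (q x) *\<^sub>R Q x b + (f'' (q x) * (b \<bullet> Dq x)) *\<^sub>R Dq x) \<bullet> b)
        = f' (q x) * (4 * a - (4 * a + 4) * y) + (f'' (q x) * q x) * (4 + E)"
      unfolding trace_compose_real trQ nD by (simp add: y_def)
    \<comment> \<open>The leading terms 4 a cancel, since the main part of the profile is harmonic
      for the untilted norm. The correction term leaves - \<sigma>; the other two summands are the
      errors of the tilt.\<close>
    also have "\<dots> = P * (- \<sigma> + (1 + \<sigma>) * ((4 * a + 4) * y) + (a + (a - 1/4) * \<sigma>) * E)"
      unfolding fp fpp by (simp add: algebra_simps)
    also have "\<dots> < 0"
    proof -
      have s0: "\<sigma> \<ge> 0" by (simp add: \<sigma>_def)
      have "(1 + \<sigma>) * ((4 * a + 4) * y) \<le> (1 + \<sigma>) * ((4 * a + 4) * z)"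
        using yz a s0 by (intro mult_left_mono) auto
      also have "\<dots> \<le> 2 * ((4 * a + 4) * z)" using z a \<sigma>1 by (intro mult_right_mono) auto
      finally have e1: "(1 + \<sigma>) * ((4 * a + 4) * y) \<le> 2 * ((4 * a + 4) * z)" .
      have "(a - 1/4) * \<sigma> \<le> a * 1" using a \<sigma>1 s0 by (intro mult_mono) auto
      then have b: "a + (a - 1/4) * \<sigma> \<le> 2 * a" by simp
      have "(a + (a - 1/4) * \<sigma>) * E \<le> (a + (a - 1/4) * \<sigma>) * (9 * z)"
        using E a s0 by (intro mult_left_mono) auto
      also have "\<dots> \<le> 2 * a * (9 * z)" using b z by (intro mult_right_mono) auto
      finally have "- \<sigma> + (1 + \<sigma>) * ((4 * a + 4) * y) + (a + (a - 1/4) * \<sigma>) * E \<le>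
          - \<sigma> + 2 * ((4 * a + 4) * z) + 2 * a * (9 * z)" using e1 by linarith
      also have "\<dots> = - \<sigma> + A * z" by (simp add: A_def algebra_simps)
      also have "\<dots> < 0" using \<sigma>2 by simp
      finally show ?thesis using P by (simp add: mult_pos_neg)
    qed
    finally have tr: "\<exists>H. (D\<Phi> has_derivative H) (at x) \<and> (\<Sum>b\<in>Basis. H b \<bullet> b) < 0"
      using HP by blast
    have nor: "D\<Phi> x \<bullet> \<nu> > 0" if \<nu>: "\<bar>\<nu> \<bullet> x\<bar> \<le> C * t\<^sup>2" "\<nu> \<bullet> m \<ge> 1/2" for \<nu>
    proof -
      have "2 * (1 - y) * (\<nu> \<bullet> x) \<le> 2 * (1 - y) * (C * t\<^sup>2)"
        using \<nu>(1) yz z by (intro mult_left_mono) auto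
      also have "\<dots> \<le> 3 * (C * t\<^sup>2)"
        using yz z C by (intro mult_right_mono) auto
      finally have 1: "2 * (1 - y) * (\<nu> \<bullet> x) \<le> 3 * (C * t\<^sup>2)" .
      have 2: "K * t\<^sup>2 * (\<nu> \<bullet> m) \<ge> K * t\<^sup>2 * (1/2)"
        using \<nu>(2) K by (intro mult_left_mono) auto
      have "Dq x \<bullet> \<nu> = 2 * (1 - y) * (\<nu> \<bullet> x) - K * t\<^sup>2 * (\<nu> \<bullet> m)"
        by (simp add: Dq_def inner_diff_right inner_commute[of _ \<nu>] y_def t_def)
      also have "\<dots> \<le> 3 * (C * t\<^sup>2) - K * t\<^sup>2 * (1/2)" using 1 2 by linarith
      also have "\<dots> = - (C + 1/2) * t\<^sup>2" by (simp add: K_def algebra_simps)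
      also have "\<dots> < 0" using C t2 by (intro mult_neg_pos) auto
      finally have "Dq x \<bullet> \<nu> < 0" .
      moreover have "f' (q x) < 0"
        unfolding fp using P by (simp add: \<sigma>_def mult_neg_pos add_pos_nonneg)
      ultimately show ?thesis by (simp add: D\<Phi>_def mult_neg_neg)
    qed
    show ?thesis
      using GP tr nor fg[OF t(1,2) qpos q2] by (auto simp: \<Phi>_def t_def)
  qed
  show ?thesis
    using r c main by (intro exI[of _ \<Phi>] exI[of _ D\<Phi>] exI[of _ r] exI[of _ c]) auto
qed

subsection \<open>Removing the singularity\<close>

text \<open>A single radius serves all levels \<open>c\<close>, so the level may be fixed afterwards
  from a maximum of \<open>u\<close> away from \<open>0\<close>. If u - \<epsilon> \<Phi> exceeded
  \<open>c\<close> somewhere, it would have a maximum: not near \<open>0\<close> by growth, not on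
  the sphere by assumption, not inside by strictness, and not on the boundary by the normal
  derivatives.\<close>

lemma bounded_above_near_singularity:
  fixes u :: "'a::euclidean_space \<Rightarrow> real"
  assumes dim: "DIM('a) \<ge> 2" and dom: "C2_domain \<Omega>" "0 \<in> frontier \<Omega>"
    and u: "harmonic_gradient \<Omega> u Du"
    and cont: "continuous_on (closure \<Omega> - {0}) u" "continuous_on (closure \<Omega> - {0}) Du"
    and bd: "\<And>x. x \<in> frontier \<Omega> - {0} \<Longrightarrow> u x > 0 \<Longrightarrow> Du x \<bullet> outward_normal \<Omega> x \<le> 0"
    and growth: "\<And>c. c > 0 \<Longrightarrow> \<forall>\<^sub>F x in at 0 within (closure \<Omega> - {0}).
        u x \<le> c * \<bar>fundamental_growth DIM('a) (norm x)\<bar>"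
  shows "\<exists>r>0. \<forall>c\<ge>0. (\<forall>x\<in>closure \<Omega> \<inter> sphere 0 r. u x \<le> c) \<longrightarrow>
     (\<forall>x\<in>closure \<Omega> \<inter> cball 0 r - {0}. u x \<le> c)"
proof -
  have "open \<Omega>" using dom(1) by (simp add: C2_domain_def)
  have Om0: "0 \<notin> \<Omega>" using dom(2) \<open>open \<Omega>\<close> by (simp add: frontier_def interior_open)
  obtain r1 C where r1: "r1 > 0" and C: "C \<ge> 0"
    and nor: "\<forall>x\<in>frontier \<Omega> \<inter> ball 0 r1.
     \<bar>outward_normal \<Omega> x \<bullet> (x - 0)\<bar> \<le> C * (norm (x - 0))\<^sup>2 \<and>
     outward_normal \<Omega> x \<bullet> outward_normal \<Omega> 0 \<ge> 1/2"
    using C2_domain_normal_near[OF dom] by blast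
  have "norm (outward_normal \<Omega> 0) = 1"
    by (rule has_outward_normal_norm[OF outward_normal[OF dom]])
  from singular_barrier[OF dim this C] obtain \<Phi> D\<Phi> r2 k where r2: "r2 > 0" and k: "k > 0"
    and bar: "\<forall>x. 0 < norm x \<and> norm x < r2 \<longrightarrow>
     GDERIV \<Phi> x :> D\<Phi> x \<and>
     (\<exists>H. (D\<Phi> has_derivative H) (at x) \<and> (\<Sum>b\<in>Basis. H b \<bullet> b) < 0) \<and>
     fundamental_growth DIM('a) (norm x) > 0 \<and>
     \<Phi> x \<ge> k * fundamental_growth DIM('a) (norm x) \<and>
     (\<forall>\<nu>. \<bar>\<nu> \<bullet> x\<bar> \<le> C * (norm x)\<^sup>2 \<and> \<nu> \<bullet> outward_normal \<Omega> 0 \<ge> 1/2 \<longrightarrow> D\<Phi> x \<bullet> \<nu> > 0)"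
    by blast
  define r where "r = min r1 r2 / 2"
  have r: "r > 0" "r < r1" "r < r2" using r1 r2 by (auto simp: r_def min_def)
  define W where "W = closure \<Omega> \<inter> cball 0 r - {0}"
  have WS: "W \<subseteq> closure \<Omega> - {0}" by (auto simp: W_def)
  have Wn: "0 < norm x \<and> norm x < r2" if "x \<in> W" for x
    using that r by (auto simp: W_def)
  have gpos: "fundamental_growth DIM('a) (norm x) > 0"
    and ge: "\<Phi> x \<ge> k * fundamental_growth DIM('a) (norm x)"
    and GP: "GDERIV \<Phi> x :> D\<Phi> x"
    and HP: "\<exists>H. (D\<Phi> has_derivative H) (at x) \<and> (\<Sum>b\<in>Basis. H b \<bullet> b) < 0" if "x \<in> W" for x
    using bar[rule_format, OF Wn[OF that]] by blast+
  have Ppos: "\<Phi> x > 0" if "x \<in> W" for x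
    using gpos[OF that] ge[OF that] k by (meson less_le_trans mult_pos_pos)
  have main: "u x1 - \<epsilon> * \<Phi> x1 \<le> c"
    if c: "c \<ge> 0" "\<And>x. x \<in> closure \<Omega> \<inter> sphere 0 r \<Longrightarrow> u x \<le> c" and \<epsilon>: "\<epsilon> > 0" and x1: "x1 \<in> W"
    for c \<epsilon> x1
  proof (rule ccontr)
    define w where "w x = u x + - \<epsilon> * \<Phi> x" for x
    define Dw where "Dw x = Du x + - \<epsilon> *\<^sub>R D\<Phi> x" for x
    assume "\<not> u x1 - \<epsilon> * \<Phi> x1 \<le> c"
    then have w1: "w x1 > c" by (simp add: w_def)
    have GeP: "GDERIV (\<lambda>x. - \<epsilon> * \<Phi> x) x :> - \<epsilon> *\<^sub>R D\<Phi> x" if "x \<in> W" for x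
      using GP[OF that] unfolding gderiv_def
      by (auto intro!: derivative_eq_intros)
    have cP: "continuous_on W \<Phi>" "continuous_on W D\<Phi>"
      using GP HP unfolding gderiv_def
      by (intro continuous_at_imp_continuous_on ballI; force dest: has_derivative_continuous)+
    have cw: "continuous_on W w" "continuous_on W Dw"
      unfolding w_def Dw_def using cont WS
      by (auto intro!: continuous_intros cP intro: continuous_on_subset)
    \<comment> \<open>The factor \<epsilon> k turns the growth condition into u \<le> \<epsilon>
      \<Phi> near \<open>0\<close>.\<close>
    obtain \<delta> where \<delta>: "\<delta> > 0" "\<And>x. x \<in> closure \<Omega> - {0} \<Longrightarrow> norm x < \<delta> \<Longrightarrow>
        u x \<le> \<epsilon> * k * \<bar>fundamental_growth DIM('a) (norm x)\<bar>"
      using growth[of "\<epsilon> * k"] \<epsilon> k by (auto simp: eventually_at)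
    have wnear: "w x \<le> 0" if x: "x \<in> W" "norm x < \<delta>" for x
    proof -
      have "u x \<le> \<epsilon> * (k * fundamental_growth DIM('a) (norm x))"
        using \<delta>(2)[of x] x WS gpos[OF x(1)] by (auto simp: mult.assoc)
      also have "\<dots> \<le> \<epsilon> * \<Phi> x" using ge[OF x(1)] \<epsilon> by (intro mult_left_mono) auto
      finally show ?thesis by (simp add: w_def)
    qed
    define K where "K = closure \<Omega> \<inter> cball 0 r - ball 0 \<delta>"
    have K: "compact K" unfolding K_def by (intro compact_diff closed_Int_compact) auto
    have KW: "K \<subseteq> W" using \<delta>(1) by (auto simp: K_def W_def)
    have inK: "x \<in> K" if "x \<in> W" "w x > 0" for x
      using wnear[of x] that by (force simp: K_def W_def)
    have "x1 \<in> K" using inK[OF x1] w1 c(1) by simp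
    then obtain y where y: "y \<in> K" "\<And>z. z \<in> K \<Longrightarrow> w z \<le> w y"
      using continuous_attains_sup[OF K, of w] continuous_on_subset[OF cw(1) KW] by blast
    have yW: "y \<in> W" using y(1) KW by blast
    have wy: "w y > c" using y(2)[OF \<open>x1 \<in> K\<close>] w1 by simp
    \<comment> \<open>Outside the compact set \<open>K\<close> one has w \<le> 0 \<le> c < w y, so
      the maximum over \<open>K\<close> is one over \<open>W\<close>.\<close>
    have max: "w z \<le> w y" if "z \<in> W" for z
      using y(2)[of z] inK[OF that] wy c(1) by (cases "w z > 0") auto
    have uy: "u y > c" using wy mult_pos_pos[OF \<epsilon> Ppos[OF yW]] by (simp add: w_def)
    have yr: "norm y < r" using c(2)[of y] uy yW by (force simp: W_def)
    define V where "V = \<Omega> \<inter> ball 0 r"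
    have V: "open V" "V \<subseteq> \<Omega>" unfolding V_def using \<open>open \<Omega>\<close> by auto
    have VW: "V \<subseteq> W" using Om0 closure_subset[of \<Omega>] by (auto simp: V_def W_def)
    show False
    proof (cases "y \<in> \<Omega>")
      case True
      then have yV: "y \<in> V" using yr by (simp add: V_def)
      obtain H where H: "(D\<Phi> has_derivative H) (at y)" "(\<Sum>b\<in>Basis. H b \<bullet> b) < 0"
        using HP[OF yW] by blast
      have H1: "((\<lambda>x. - \<epsilon> *\<^sub>R D\<Phi> x) has_derivative (\<lambda>h. - \<epsilon> *\<^sub>R H h)) (at y)"
        by (rule has_derivative_scaleR_right[OF H(1)])
      have H2: "(\<Sum>b\<in>Basis. (- \<epsilon> *\<^sub>R H b) \<bullet> b) > 0"
        using H(2) \<epsilon> by (simp add: sum_negf mult_pos_neg flip: sum_distrib_left)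
      have "\<exists>z\<in>V. u z + - \<epsilon> * \<Phi> z > u y + - \<epsilon> * \<Phi> y"
        by (rule harmonic_plus_strict_subharmonic_no_max[OF u V yV GeP H1 H2]) (use VW in blast)
      then show False using max VW by (force simp: w_def)
    next
      case False
      then have yf: "y \<in> frontier \<Omega>" "y \<in> frontier \<Omega> - {0}"
        using yW \<open>open \<Omega>\<close> by (auto simp: W_def frontier_def interior_open)
      define \<nu> where "\<nu> = outward_normal \<Omega> y"
      have n: "has_outward_normal \<Omega> y \<nu>" unfolding \<nu>_def by (rule outward_normal[OF dom(1) yf(1)])
      have "\<nu> \<bullet> (- \<nu>) < 0" using has_outward_normal_norm[OF n] by (simp add: norm_eq_1)
      then have "\<forall>\<^sub>F t in at_right 0. y + t *\<^sub>R (- \<nu>) \<in> \<Omega>"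
        by (rule has_outward_normal_descent(1)[OF n yf(1)])
      moreover have "\<forall>\<^sub>F t in at_right 0. y + t *\<^sub>R (- \<nu>) \<in> ball 0 r"
        by (rule filter_leD[OF at_within_le_nhds eventually_line_in_open]) (use yr in auto)
      ultimately have seg: "\<forall>\<^sub>F t in at_right 0. y + t *\<^sub>R (- \<nu>) \<in> V"
        unfolding V_def by eventually_elim auto
      \<comment> \<open>At a boundary maximum the outward derivative of \<open>w\<close> is
        nonnegative, whereas that of \<open>u\<close> is nonpositive and that of \<Phi> is
        positive.\<close>
      have "Dw y \<bullet> (- \<nu>) \<le> 0"
      proof (rule one_sided_derivative_nonpos[OF seg VW yW])
        show "GDERIV w x :> Dw x" if "x \<in> V" for x
          unfolding w_def Dw_def using that u V VW
          by (intro GDERIV_add GeP) (auto simp: harmonic_gradient_def)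
        show "continuous (at y within W) w" "continuous (at y within W) Dw"
          using cw yW by (auto simp: continuous_on_eq_continuous_within)
        show "\<forall>\<^sub>F t in at_right 0. w (y + t *\<^sub>R - \<nu>) \<le> w y"
          using seg by eventually_elim (use max VW in blast)
      qed
      then have "Du y \<bullet> \<nu> - \<epsilon> * (D\<Phi> y \<bullet> \<nu>) \<ge> 0"
        by (simp add: Dw_def inner_diff_left)
      moreover have "Du y \<bullet> \<nu> \<le> 0" unfolding \<nu>_def using bd[OF yf(2)] uy c(1) by simp
      moreover have "D\<Phi> y \<bullet> \<nu> > 0"
        using bar[rule_format, OF Wn[OF yW]] nor[rule_format, of y] yf yr r unfolding \<nu>_def by simp
      ultimately show False using mult_pos_pos[OF \<epsilon>, of "D\<Phi> y \<bullet> \<nu>"] by linarith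
    qed
  qed
  have "u x \<le> c" if "c \<ge> 0" "\<And>x. x \<in> closure \<Omega> \<inter> sphere 0 r \<Longrightarrow> u x \<le> c" "x \<in> W" for c x
  proof (rule field_le_epsilon)
    fix e :: real assume "e > 0"
    then show "u x \<le> c + e"
      \<comment> \<open>At the fixed point \<open>x\<close> this choice of \<epsilon> makes the
        barrier term exactly \<open>e\<close>.\<close>
      using main[OF that(1,2), of "e / \<Phi> x" x] Ppos[OF that(3)] that(3) by simp
  qed
  then show ?thesis using r(1) unfolding W_def by blast
qed

section \<open>From the local bound to a global dichotomy\<close>

lemma constant_on_dense_extension:
  fixes f :: "'a::topological_space \<Rightarrow> 'b::t1_space"
  assumes "continuous_on T f" "U \<subseteq> T" "T \<subseteq> closure U" "\<And>x. x \<in> U \<Longrightarrow> f x = a" "x \<in> T"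
  shows "f x = a"
proof -
  have "closedin (top_of_set T) {x \<in> T. f x = a}"
    by (rule continuous_closedin_preimage_constant[OF assms(1)])
  then obtain Z where Z: "closed Z" "{x \<in> T. f x = a} = T \<inter> Z"
    by (auto simp: closedin_closed)
  then have "U \<subseteq> Z" using assms(2,4) by blast
  then have "closure U \<subseteq> Z" using Z(1) by (rule closure_minimal)
  then show ?thesis using Z(2) assms(3,5) by blast
qed

text \<open>The hypotheses are one-sided so that they can be met by both \<open>u\<close> and
  \<open>- u\<close>. The local bound at level \<open>max 0 (u y)\<close> promotes the maximum over
  the compact part \<open>K\<close> away from \<open>0\<close> to a maximum over the whole set,
  provided \<open>u\<close> is positive somewhere.\<close>

lemma nonpos_or_constant:
  fixes u :: "'a::euclidean_space \<Rightarrow> real"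
  assumes dim: "DIM('a) \<ge> 2" and bdd: "bounded \<Omega>" and dom: "C2_domain \<Omega>" "0 \<in> frontier \<Omega>"
    and u: "harmonic_gradient \<Omega> u Du"
    and cont: "continuous_on (closure \<Omega> - {0}) u" "continuous_on (closure \<Omega> - {0}) Du"
    and bd: "\<And>x. x \<in> frontier \<Omega> - {0} \<Longrightarrow> u x > 0 \<Longrightarrow> Du x \<bullet> outward_normal \<Omega> x \<le> 0"
    and growth: "\<And>c. c > 0 \<Longrightarrow> \<forall>\<^sub>F x in at 0 within (closure \<Omega> - {0}).
        u x \<le> c * \<bar>fundamental_growth DIM('a) (norm x)\<bar>"
  shows "(\<forall>x\<in>closure \<Omega> - {0}. u x \<le> 0) \<or> u constant_on (closure \<Omega> - {0})"
proof (cases "\<forall>x\<in>closure \<Omega> - {0}. u x \<le> 0")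
  case False
  define S where "S = closure \<Omega> - {0}"
  obtain x1 where x1: "x1 \<in> S" "u x1 > 0" using False by (auto simp: S_def not_le)
  have Om: "open \<Omega>" "connected \<Omega>" using dom(1) by (auto simp: C2_domain_def)
  have OS: "\<Omega> \<subseteq> S"
    using dom(2) Om(1) closure_subset[of \<Omega>] by (auto simp: S_def frontier_def interior_open)
  obtain r where r: "r > 0" and loc: "\<And>c x. c \<ge> 0 \<Longrightarrow> (\<And>x. x \<in> closure \<Omega> \<inter> sphere 0 r \<Longrightarrow> u x \<le> c) \<Longrightarrow>
      x \<in> closure \<Omega> \<inter> cball 0 r - {0} \<Longrightarrow> u x \<le> c"
    using bounded_above_near_singularity[OF dim dom u cont bd growth] by blast
  define K where "K = closure \<Omega> - ball 0 r"
  have K: "compact K" unfolding K_def using bdd by (intro compact_diff) auto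
  have KS: "K \<subseteq> S" using r by (auto simp: K_def S_def)
  have SK: "x \<in> K \<or> x \<in> closure \<Omega> \<inter> cball 0 r - {0}" if "x \<in> S" for x
    using that by (auto simp: K_def S_def)
  have sphK: "closure \<Omega> \<inter> sphere 0 r \<subseteq> K" by (auto simp: K_def)
  have "K \<noteq> {}"
  proof
    assume "K = {}"
    \<comment> \<open>With \<open>K\<close> empty the sphere misses the closure, so the local bound
      holds vacuously at level 0.\<close>
    then have "u x1 \<le> 0" using loc[of 0 x1] sphK SK[OF x1(1)] by blast
    with x1 show False by simp
  qed
  then obtain y where y: "y \<in> K" "\<And>z. z \<in> K \<Longrightarrow> u z \<le> u y"
    using continuous_attains_sup[OF K, of u] continuous_on_subset[OF cont(1)] KS S_def by blast
  have le: "u x \<le> max 0 (u y)" if "x \<in> S" for x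
    using SK[OF that]
  proof
    assume "x \<in> K"
    then show ?thesis using y(2)[of x] by simp
  next
    assume "x \<in> closure \<Omega> \<inter> cball 0 r - {0}"
    moreover have "u z \<le> max 0 (u y)" if "z \<in> closure \<Omega> \<inter> sphere 0 r" for z
      using y(2)[OF subsetD[OF sphK that]] by simp
    ultimately show ?thesis by (rule loc[OF max.cobounded1, rotated])
  qed
  have uy: "u y > 0" using le[OF x1(1)] x1(2) by (simp add: max_def split: if_splits)
  then have max: "u x \<le> u y" if "x \<in> S" for x using le[OF that] by simp
  have "\<exists>x0\<in>\<Omega>. u x0 = u y"
  proof (rule ccontr)
    assume no: "\<not> ?thesis"
    then have less: "u x < u y" if "x \<in> \<Omega>" for x using max[of x] OS that by force
    have yf: "y \<in> frontier \<Omega>" "y \<in> frontier \<Omega> - {0}"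
      using y(1) KS no Om(1) by (auto simp: S_def frontier_def interior_open)
    define \<nu> where "\<nu> = outward_normal \<Omega> y"
    have n\<nu>: "norm \<nu> = 1" unfolding \<nu>_def
      by (rule has_outward_normal_norm[OF outward_normal[OF dom(1) yf(1)]])
    obtain R where R: "R > 0" "cball (y - R *\<^sub>R \<nu>) R - {y} \<subseteq> \<Omega>"
      using C2_domain_interior_ball[OF dom(1) yf(1), of 1] unfolding \<nu>_def by auto
    have dy: "dist (y - R *\<^sub>R \<nu>) y = R" using n\<nu> R(1) by (simp add: dist_norm)
    have bO: "ball (y - R *\<^sub>R \<nu>) R \<subseteq> \<Omega>" using R(2) dy by force
    have cS: "cball (y - R *\<^sub>R \<nu>) R \<subseteq> S" using R(2) OS y(1) KS by blast
    have "Du y \<bullet> (y - (y - R *\<^sub>R \<nu>)) > 0"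
      by (rule hopf_ball[OF u bO cS cont[folded S_def] dy R(1)]) (use less bO max cS in blast)+
    then have "Du y \<bullet> \<nu> > 0" using R(1) by (simp add: zero_less_mult_iff)
    then show False using bd[OF yf(2) uy] by (simp add: \<nu>_def)
  qed
  then obtain x0 where x0: "x0 \<in> \<Omega>" "u x0 = u y" by blast
  have "u x = u y" if "x \<in> \<Omega>" for x
    using harmonic_strong_maximum_principle[OF u Om(2) x0(1) _ that] max OS x0 by auto
  then have "u x = u y" if "x \<in> S" for x
    using constant_on_dense_extension[OF cont(1)[folded S_def] OS _ _ that] by (auto simp: S_def)
  then show ?thesis by (auto simp: constant_on_def S_def)
qed simp

section \<open>Reducing the theorem to the dichotomy\<close>

text \<open>The gradient supplied by \<open>C2_on\<close> and the field \<open>Du\<close> are a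
  priori different witnesses; uniqueness of derivatives identifies them on the open set, so the
  second derivative passes to \<open>Du\<close>.\<close>

lemma harmonic_gradientI:
  assumes "open \<Omega>" "C2_on u \<Omega>" "\<And>x. x \<in> \<Omega> \<Longrightarrow> GDERIV u x :> Du x"
    and "\<And>x. x \<in> \<Omega> \<Longrightarrow> laplacian u x = 0"
  shows "harmonic_gradient \<Omega> u Du"
  unfolding harmonic_gradient_def
proof (intro conjI ballI)
  obtain Df D2f where f: "\<And>x. x \<in> \<Omega> \<Longrightarrow> GDERIV u x :> Df x"
    "\<And>x. x \<in> \<Omega> \<Longrightarrow> (Df has_derivative blinfun_apply (D2f x)) (at x)"
    using assms(2) by (auto simp: C2_on_def)
  have eq: "Df x = Du x" if "x \<in> \<Omega>" for x
  proof -
    have "(\<lambda>h. h \<bullet> Df x) = (\<lambda>h. h \<bullet> Du x)"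
      using f(1)[OF that] assms(3)[OF that] unfolding gderiv_def by (rule has_derivative_unique)
    then show ?thesis by (metis inner_commute vector_eq_ldot)
  qed
  show "\<exists>H. (Du has_derivative H) (at x) \<and> (\<Sum>b\<in>Basis. H b \<bullet> b) = 0" if x: "x \<in> \<Omega>" for x
  proof -
    have H: "(Du has_derivative blinfun_apply (D2f x)) (at x)"
      using has_derivative_transform_within_open[OF f(2)[OF x] assms(1) x] eq by blast
    show ?thesis
      using H laplacian_eq_trace[OF assms(1) x assms(3) H] assms(4)[OF x] by auto
  qed
qed (use assms in auto)

text \<open>In dimension at least 2 the punctured space is connected. It meets \<Omega> and, by
  boundedness, also the complement, so it meets the frontier. This supplies the point at which
  \<open>g\<close> is evaluated.\<close>

lemma frontier_not_singleton:
  fixes \<Omega> :: "'a::euclidean_space set"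
  assumes "DIM('a) \<ge> 2" "bounded \<Omega>" "open \<Omega>" "\<Omega> \<noteq> {}" "a \<in> frontier \<Omega>"
  shows "\<exists>x. x \<in> frontier \<Omega> - {a}"
proof -
  have a: "a \<notin> \<Omega>" using assms(3,5) by (simp add: frontier_def interior_open)
  have "connected (- {a})" by (rule connected_punctured_universe) (use assms(1) in simp)
  moreover have "- {a} \<inter> \<Omega> \<noteq> {}" using a assms(4) by auto
  moreover have "- {a} - \<Omega> \<noteq> {}"
  proof
    assume "- {a} - \<Omega> = {}"
    then have "UNIV = insert a \<Omega>" by auto
    then show False using assms(2) not_bounded_UNIV by (metis bounded_insert)
  qed
  ultimately have "- {a} \<inter> frontier \<Omega> \<noteq> {}" by (rule connected_Int_frontier)
  then show ?thesis by auto
qed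

theorem theoremB:
  fixes \<Omega> :: "(real ^ 'n) set"
    and g :: "real \<Rightarrow> real"
    and u :: "real ^ 'n \<Rightarrow> real"
    and Du :: "real ^ 'n \<Rightarrow> real ^ 'n"
  assumes dim: "CARD('n) \<ge> 2"
    and domain: "bounded \<Omega>" "C2_domain \<Omega>" "0 \<in> frontier \<Omega>"
    and g_cont: "continuous_on UNIV g"
    and g_sign: "\<forall>s. s * g s \<ge> 0"
    and u_C1: "C1_up_to \<Omega> (closure \<Omega> - {0}) u Du"
    and u_C2: "C2_on u \<Omega>"
    and equation: "\<forall>x\<in>\<Omega>. - laplacian u x = 0"
    and boundary: "\<forall>x\<in>frontier \<Omega> - {0}. Du x \<bullet> outward_normal \<Omega> x + g (u x) = 0"
    and growth_ge3: "CARD('n) \<ge> 3 \<longrightarrow>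
      u \<in> o[at 0 within (closure \<Omega> - {0})](\<lambda>x. norm x powr (2 - real CARD('n)))"
    and growth_2: "CARD('n) = 2 \<longrightarrow>
      u \<in> o[at 0 within (closure \<Omega> - {0})](\<lambda>x. ln (norm x))"
  shows "u constant_on (closure \<Omega> - {0}) \<and> (\<forall>x\<in>closure \<Omega> - {0}. g (u x) = 0)"
proof -
  define S where "S = closure \<Omega> - {0}"
  have D: "DIM(real ^ 'n) \<ge> 2" using dim by simp
  have Om: "open \<Omega>" "\<Omega> \<noteq> {}" using domain(2) by (auto simp: C2_domain_def)
  have OS: "\<Omega> \<subseteq> S"
    using domain(3) Om(1) closure_subset[of \<Omega>] by (auto simp: S_def frontier_def interior_open)
  have cont: "continuous_on S u" "continuous_on S Du" and G: "\<And>x. x \<in> \<Omega> \<Longrightarrow> GDERIV u x :> Du x"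
    using u_C1 by (auto simp: C1_up_to_def S_def)
  have u: "harmonic_gradient \<Omega> u Du"
    by (rule harmonic_gradientI[OF Om(1) u_C2 G]) (use equation in auto)
  then have mu: "harmonic_gradient \<Omega> (\<lambda>x. - u x) (\<lambda>x. - Du x)"
    unfolding harmonic_gradient_def gderiv_def
    by (fastforce intro: derivative_eq_intros simp: sum_negf)
  have growth: "\<forall>\<^sub>F x in at 0 within S. \<bar>u x\<bar> \<le> c * \<bar>fundamental_growth DIM(real ^ 'n) (norm x)\<bar>"
    if "c > 0" for c
  proof (cases "CARD('n) = 2")
    case True
    then show ?thesis
      using landau_o.smallD[OF growth_2[rule_format] that]
      by (simp add: fundamental_growth_def S_def)
  next
    case False
    then show ?thesis
      using landau_o.smallD[OF growth_ge3[rule_format] that] dim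
      by (simp add: fundamental_growth_def S_def)
  qed
  have gs: "g s \<ge> 0" if "s > 0" for s using g_sign that by (simp add: zero_le_mult_iff) (metis not_le)
  have gs': "g s \<le> 0" if "s < 0" for s using g_sign that by (simp add: zero_le_mult_iff) (metis not_le)
  have B: "Du x \<bullet> outward_normal \<Omega> x = - g (u x)" if "x \<in> frontier \<Omega> - {0}" for x
    using boundary that by (simp add: eq_neg_iff_add_eq_0)
  have 1: "(\<forall>x\<in>S. u x \<le> 0) \<or> u constant_on S"
    unfolding S_def
  proof (rule nonpos_or_constant[OF D domain u])
    show "\<forall>\<^sub>F x in at 0 within (closure \<Omega> - {0}). u x \<le> c * \<bar>fundamental_growth DIM(real ^ 'n) (norm x)\<bar>"
      if "c > 0" for c
      using growth[OF that] unfolding S_def by eventually_elim linarith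
  qed (use cont gs B in \<open>auto simp: S_def\<close>)
  have 2: "(\<forall>x\<in>S. - u x \<le> 0) \<or> (\<lambda>x. - u x) constant_on S"
    unfolding S_def
  \<comment> \<open>Where \<open>- u > 0\<close>, the outward derivative of \<open>- u\<close> is
    \<open>g (u x)\<close> with a negative argument, hence nonpositive.\<close>
  proof (rule nonpos_or_constant[OF D domain mu])
    show "\<forall>\<^sub>F x in at 0 within (closure \<Omega> - {0}). - u x \<le> c * \<bar>fundamental_growth DIM(real ^ 'n) (norm x)\<bar>"
      if "c > 0" for c
      using growth[OF that] unfolding S_def by eventually_elim linarith
  qed (use cont gs' B in \<open>auto simp: S_def intro: continuous_intros\<close>)
  have const: "u constant_on S"
    using 1 2
  proof (elim disjE)
    assume "\<forall>x\<in>S. u x \<le> 0" "\<forall>x\<in>S. - u x \<le> 0"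
    then have "\<forall>x\<in>S. u x = 0" by force
    then show ?thesis by (auto simp: constant_on_def)
  next
    assume "(\<lambda>x. - u x) constant_on S"
    then show ?thesis unfolding constant_on_def by (metis minus_minus)
  qed
  then obtain c where c: "\<And>x. x \<in> S \<Longrightarrow> u x = c" by (auto simp: constant_on_def)
  obtain y where y: "y \<in> frontier \<Omega> - {0}"
    using frontier_not_singleton[OF D domain(1) Om domain(3)] by blast
  have yS: "y \<in> S" using y by (simp add: S_def frontier_def)
  \<comment> \<open>Every point is a maximum of a constant function.\<close>
  have "Du x = 0" if "x \<in> \<Omega>" for x
    by (rule gradient_zero_at_max[OF Om(1) that G[OF that]]) (simp add: c[OF subsetD[OF OS]] that)
  then have "Du y = 0"
    using constant_on_dense_extension[OF cont(2) OS _ _ yS] by (auto simp: S_def)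
  then have "g c = 0" using B[OF y] c[OF yS] by simp
  then show ?thesis using const c by (auto simp: S_def)
qed

end
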